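(* Let $\nu>0$, and for $j=1,2$ let $Y_j=\{Y_j(t):t\in\mathbb{R}^4\}$ be a mean-zero stationary Matérn Gaussian random field on $\mathbb{R}^4$ with parameters $\sigma_j>0$, $\alpha_j>0$ and common smoothness $\nu$. Assume $$\sigma_1^2\alpha_1^{2\nu}=\sigma_2^2\alpha_2^{2\nu},\qquad \alpha_1\neq\alpha_2 .$$ Let $D\subset\mathbb{R}^4$ be a bounded domain with nonempty interior and let $S\subset D$ be countable and dense in $D$. Denote by $\mathbf{P}_j^S$ the law of the coordinate process $\{Y_j(t):t\in S\}$ on $\mathbb{R}^S$. Then $\mathbf{P}_1^S\perp\mathbf{P}_2^S$, i.e. the two laws are mutually singular. In particular, for the dense grid $$D_\infty:=\bigcup_{n\ge1} \bigl(D\cap n^{-1}\mathbb{Z}^4\bigr),$$ the laws of the coordinate processes $\{Y_j(t):t\in D_\infty\}$, $j=1,2$, are mutually singular.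
   Context: The Matérn field on $\mathbb{R}^4$ with parameters $\sigma,\alpha,\nu>0$ is the real-valued mean-zero stationary Gaussian field with covariance $\mathrm{Cov}(Y(s),Y(t))=K(t-s)$, where $$K(h)=\sigma^2\frac{(\alpha|h|)^\nu}{2^{\nu-1}\Gamma(\nu)}\mathcal{K}_\nu(\alpha|h|)\quad(h\ne0),\qquad K(0)=\sigma^2,$$ $|\cdot|$ is the Euclidean norm and $\mathcal{K}_\nu$ is the modified Bessel function of the second kind. Equivalently, $K(h)=(2\pi)^{-4}\int_{\mathbb{R}^4}e^{i\xi\cdot h}f(\xi)\,d\xi$ with spectral density $f(\xi)=C_\nu\sigma^2\alpha^{2\nu}(\alpha^2+|\xi|^2)^{-(\nu+2)}$, where $C_\nu>0$ depends only on $\nu$. The space $\mathbb{R}^S$ carries the product $\sigma$-field. *)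

theory Defs
  imports "HOL-Probability.Probability"
begin

(* Modified Bessel function of the second kind, for x > 0, by its integral representation
   K_nu(x) = int_0^oo exp (- x cosh t) cosh (nu t) dt. The integrand is absolutely integrable
   for every real nu, including integer nu, where the quotient
   (pi / 2) (I_{-nu} - I_nu) / sin (nu pi) would have to be read as a limit. *)
definition bessel_K :: "real \<Rightarrow> real \<Rightarrow> real" where
  "bessel_K \<nu> x = (LINT t:{0..}|lborel. exp (- x * cosh t) * cosh (\<nu> * t))"

definition matern_cov :: "real \<Rightarrow> real \<Rightarrow> real \<Rightarrow> real^4 \<Rightarrow> real" where
  "matern_cov \<sigma> \<alpha> \<nu> h =
     (if h = 0 then \<sigma>\<^sup>2
      else \<sigma>\<^sup>2 * ((\<alpha> * norm h) powr \<nu> / (2 powr (\<nu> - 1) * Gamma \<nu>)) * bessel_K \<nu> (\<alpha> * norm h))"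

definition covariance :: "'a measure \<Rightarrow> ('a \<Rightarrow> real) \<Rightarrow> ('a \<Rightarrow> real) \<Rightarrow> real" where
  "covariance M X Z =
     (LINT \<omega>|M. (X \<omega> - (LINT \<omega>'|M. X \<omega>')) * (Z \<omega> - (LINT \<omega>'|M. Z \<omega>')))"

(* The second disjunct is the degenerate normal distribution of variance 0. *)
definition gaussian_rv :: "'a measure \<Rightarrow> ('a \<Rightarrow> real) \<Rightarrow> bool" where
  "gaussian_rv M X \<longleftrightarrow>
     X \<in> borel_measurable M \<and>
     ((\<exists>\<mu> s. s > 0 \<and> distributed M lborel X (\<lambda>x. ennreal (normal_density \<mu> s x))) \<or>
      (\<exists>\<mu>. AE \<omega> in M. X \<omega> = \<mu>))"

definition gaussian_field :: "'a measure \<Rightarrow> ('i \<Rightarrow> 'a \<Rightarrow> real) \<Rightarrow> bool" where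
  "gaussian_field M Y \<longleftrightarrow>
     prob_space M \<and>
     (\<forall>T c. finite T \<longrightarrow> gaussian_rv M (\<lambda>\<omega>. \<Sum>t\<in>T. c t * Y t \<omega>))"

definition process_law :: "'a measure \<Rightarrow> 'i set \<Rightarrow> ('i \<Rightarrow> 'a \<Rightarrow> real) \<Rightarrow> ('i \<Rightarrow> real) measure" where
  "process_law M S Y = distr M (\<Pi>\<^sub>M t\<in>S. borel) (\<lambda>\<omega>. \<lambda>t\<in>S. Y t \<omega>)"

definition stationary_field :: "'a measure \<Rightarrow> ('i::plus \<Rightarrow> 'a \<Rightarrow> real) \<Rightarrow> bool" where
  "stationary_field M Y \<longleftrightarrow>
     (\<forall>h. process_law M UNIV (\<lambda>t. Y (t + h)) = process_law M UNIV Y)"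

definition matern_field ::
    "'a measure \<Rightarrow> (real^4 \<Rightarrow> 'a \<Rightarrow> real) \<Rightarrow> real \<Rightarrow> real \<Rightarrow> real \<Rightarrow> bool" where
  "matern_field M Y \<sigma> \<alpha> \<nu> \<longleftrightarrow>
     gaussian_field M Y \<and> stationary_field M Y \<and>
     (\<forall>t. (LINT \<omega>|M. Y t \<omega>) = 0) \<and>
     (\<forall>s t. covariance M (Y s) (Y t) = matern_cov \<sigma> \<alpha> \<nu> (t - s))"

definition mutually_singular :: "'a measure \<Rightarrow> 'a measure \<Rightarrow> bool" where
  "mutually_singular P Q \<longleftrightarrow>
     sets P = sets Q \<and>
     (\<exists>A\<in>sets P. emeasure P A = 0 \<and> emeasure Q (space Q - A) = 0)"

definition dense_grid :: "(real^4) set \<Rightarrow> (real^4) set" where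
  "dense_grid D =
     (\<Union>n\<in>{1::nat..}. D \<inter> (\<lambda>z. (1 / real n) *\<^sub>R z) ` {z. \<forall>i. z $ i \<in> \<int>})"

end

theory Submission
  imports Defs
begin

text \<open>The constraint on \<open>\<sigma>\<^sup>2 \<alpha> powr (2 \<nu>)\<close> makes the leading singular terms of the two covariances at lag
  zero agree. What is left, for increments of sufficiently high order and step \<open>h\<close>, is a relative
  difference of order \<open>h\<^sup>2\<close> between their variances. In dimension four a fixed box contains about
  \<open>1 / h\<^sup>4\<close> sites at spacing \<open>h\<close>; the average of \<open>1 / h\<^sup>4\<close> weakly correlated squared increments has
  relative standard deviation of order \<open>h\<^sup>2\<close> as well. So no single scale decides between the two laws,
  but every dyadic scale carries signal and noise of the same order, and increments at very different
  scales are nearly uncorrelated. Adding up \<open>N\<close> dyadic scales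
  gives a quadratic statistic whose means under the two laws differ by at least a multiple of \<open>N\<close>,
  while its variance is at most a multiple of \<open>N\<close>. By Chebyshev's inequality it separates the laws up
  to errors of order \<open>1 / N\<close>, and Borel--Cantelli (\<open>mutually_singularI_separating\<close>) turns this into
  mutual singularity.

  The covariance is handled without Fourier analysis. It is the same multiple, for both fields, of a
  mixture of Gaussian functions of the lag (\<open>matern_cov_mixture\<close>),
    \<open>mixture \<nu> \<beta> r = (LINT t. exp (2 \<nu> t) exp (- \<beta> exp (2 t)) exp (- r\<^sup>2 / exp (2 t)))\<close> with
  \<open>\<beta> = \<alpha>\<^sup>2 / 4\<close>, and the parameter only enters through the factor \<open>exp (- \<beta> exp (2 t))\<close>, which
  decreases in \<open>\<beta>\<close>. Two estimates carry the proof. First, a Gaussian function is positive definite, so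
  the difference of the two increment variances is the integral of a nonnegative function and can be
  bounded below on a bounded range of \<open>t\<close> (\<open>comb_cov_stencil_gap\<close>). Second, differences of high order
  \<open>p\<close> in one coordinate direction make the mixture decay in units of the step, in all directions and
  fast enough to be square summable over a grid (\<open>mixture_diff_decay\<close>). By stationarity this bounds
  the squared correlations of an arbitrary combination of \<open>p + 1\<close> values of the field with all
  increments of a given step (\<open>comb_cov_sum_bound\<close>), so only the finer of two scales has to be
  differenced to see that their correlation is geometrically small (\<open>quad_var_linear\<close>).

  The sites of the statistic need not belong to \<open>S\<close>. Its mean and variance depend continuously on the
  sites, hence sites in \<open>S\<close> close to the ideal ones do as well (\<open>quad_stat_separates_closure\<close>).\<close>

section \<open>Singularity from separating events\<close>

lemma mutually_singular_sym: "mutually_singular P Q \<Longrightarrow> mutually_singular Q P"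
proof -
  assume "mutually_singular P Q"
  then obtain A where s: "sets P = sets Q" and A: "A \<in> sets P" "emeasure P A = 0"
    "emeasure Q (space Q - A) = 0" unfolding mutually_singular_def by auto
  have sp: "space P = space Q" using s by (rule sets_eq_imp_space_eq)
  have "A \<subseteq> space P" using A(1) by (rule sets.sets_into_space)
  then have "space P - (space Q - A) = A" using sp by auto
  moreover have "space Q - A \<in> sets Q" using A(1) s by auto
  ultimately show ?thesis unfolding mutually_singular_def using s A by auto
qed

text \<open>Choosing events with errors at most \<open>(1/2)^k\<close>, Borel--Cantelli applies to both measures at once: almost
  surely only finitely many of the events occur under \<open>P\<close>, and all but finitely many under \<open>Q\<close>.\<close>

lemma mutually_singularI_separating:
  assumes "prob_space P" "prob_space Q" and sets: "sets P = sets Q"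
    and sep: "\<And>e. e > 0 \<Longrightarrow> \<exists>A\<in>sets P. measure P A \<le> e \<and> measure Q (space Q - A) \<le> e"
  shows "mutually_singular P Q"
proof -
  interpret P: prob_space P by fact
  interpret Q: prob_space Q by fact
  have sp: "space P = space Q" using sets by (rule sets_eq_imp_space_eq)
  have "\<forall>k::nat. \<exists>A\<in>sets P. measure P A \<le> (1/2)^k \<and> measure Q (space Q - A) \<le> (1/2)^k"
    by (intro allI sep) simp
  then obtain A where A: "\<And>k::nat. A k \<in> sets P" "\<And>k. measure P (A k) \<le> (1/2)^k"
     "\<And>k. measure Q (space Q - A k) \<le> (1/2)^k" by metis
  have AQ: "\<And>k. A k \<in> sets Q" using A(1) sets by simp
  have geo: "summable (\<lambda>k. (1/2::real)^k)" by (simp add: summable_geometric)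
  have sumP: "summable (\<lambda>k. measure P (A k))"
    by (rule summable_comparison_test[OF _ geo]) (auto intro!: exI[of _ 0] A)
  have sumQ: "summable (\<lambda>k. measure Q (space Q - A k))"
    by (rule summable_comparison_test[OF _ geo]) (auto intro!: exI[of _ 0] A)
  have P: "AE x in P. eventually (\<lambda>n. x \<in> space P - A n) sequentially"
    using borel_cantelli_AE1[OF A(1) _ sumP] by (simp add: P.emeasure_eq_measure)
  have Q: "AE x in Q. eventually (\<lambda>n. x \<in> space Q - (space Q - A n)) sequentially"
    by (rule borel_cantelli_AE1[OF _ _ sumQ]) (auto simp: AQ Q.emeasure_eq_measure)
  \<comment> \<open>the limit inferior of the events\<close>
  define B where "B = {x \<in> space P. \<exists>k. \<forall>n\<ge>k. x \<in> A n}"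
  have Bm: "B \<in> sets P" unfolding B_def using A(1) by measurable
  have "AE x in P. x \<notin> B"
    using P
  proof eventually_elim
    case (elim x)
    then obtain k where k: "\<And>n. n \<ge> k \<Longrightarrow> x \<notin> A n" by (auto simp: eventually_sequentially)
    show ?case
    proof
      assume "x \<in> B"
      then obtain k' where k': "\<And>n. n \<ge> k' \<Longrightarrow> x \<in> A n" unfolding B_def by auto
      show False using k[of "max k k'"] k'[of "max k k'"] by simp
    qed
  qed
  then have 1: "emeasure P B = 0"
    using AE_iff_measurable[OF Bm, of "\<lambda>x. x \<notin> B"] sets.sets_into_space[OF Bm] by auto
  have "AE x in Q. x \<in> B"
    using Q
  proof eventually_elim
    case (elim x)
    then obtain k where k: "\<And>n. n \<ge> k \<Longrightarrow> x \<in> A n \<and> x \<in> space Q"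
      by (auto simp: eventually_sequentially)
    show ?case unfolding B_def using k sp by auto
  qed
  then have 2: "emeasure Q (space Q - B) = 0"
    using AE_iff_measurable[of "space Q - B" Q "\<lambda>x. x \<in> B"] Bm sets by auto
  show ?thesis unfolding mutually_singular_def using sets Bm 1 2 by auto
qed

section \<open>Quadratic statistics of Gaussian fields\<close>

lemma (in prob_space) centred_gaussian_moments:
  assumes g: "gaussian_rv M X" and m: "(LINT \<omega>|M. X \<omega>) = 0"
  shows "integrable M (\<lambda>\<omega>. X \<omega> ^ k)"
    and "(LINT \<omega>|M. X \<omega> ^ 4) = 3 * (LINT \<omega>|M. X \<omega> ^ 2)\<^sup>2"
proof -
  have X[measurable]: "X \<in> borel_measurable M" using g by (simp add: gaussian_rv_def)
  have "integrable M (\<lambda>\<omega>. X \<omega> ^ k) \<and> (LINT \<omega>|M. X \<omega> ^ 4) = 3 * (LINT \<omega>|M. X \<omega> ^ 2)\<^sup>2"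
  proof (cases "\<exists>\<mu> s. s > 0 \<and> distributed M lborel X (\<lambda>x. ennreal (normal_density \<mu> s x))")
    case True
    then obtain \<mu> s where s: "s > 0" and
      D: "distributed M lborel X (\<lambda>x. ennreal (normal_density \<mu> s x))" by auto
    have "\<mu> = 0"
      using distributed_integral[OF D, of "\<lambda>x. x"] integral_normal_moment_nz_1[OF s, of \<mu>] m
      by (simp add: normal_density_nonneg)
    then have D0: "distributed M lborel X (\<lambda>x. ennreal (normal_density 0 s x))" using D by simp
    have I: "integrable M (\<lambda>\<omega>. X \<omega> ^ k)"
      using distributed_integrable[OF D0, of "\<lambda>x. x^k"] integrable_normal_moment[OF s, of 0 k]
      by (simp add: normal_density_nonneg)
    have 2: "(LINT \<omega>|M. X \<omega> ^ 2) = s\<^sup>2"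
      using distributed_integral[OF D0, of "\<lambda>x. x^2"] integral_normal_moment_even[OF s, of 0 1] s
      by (simp add: normal_density_nonneg)
    have 4: "(LINT \<omega>|M. X \<omega> ^ 4) = 3 * s^4"
      using distributed_integral[OF D0, of "\<lambda>x. x^4"] integral_normal_moment_even[OF s, of 0 2] s
      by (simp add: normal_density_nonneg field_simps eval_nat_numeral)
    show ?thesis using I 2 4 by (simp flip: power_mult)
  next
    case False
    then obtain \<mu> where ae: "AE \<omega> in M. X \<omega> = \<mu>" using g by (auto simp: gaussian_rv_def)
    have pk: "(LINT \<omega>|M. X \<omega> ^ j) = \<mu>^j" for j
    proof -
      have "(LINT \<omega>|M. X \<omega> ^ j) = (LINT \<omega>|M. \<mu> ^ j)"
        by (rule integral_cong_AE) (use ae in auto)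
      then show ?thesis by (simp add: prob_space)
    qed
    have "\<mu> = 0" using pk[of 1] m by simp
    moreover have "integrable M (\<lambda>\<omega>. X \<omega> ^ k)"
      using ae by (subst integrable_cong_AE[where g="\<lambda>_. \<mu>^k"]) auto
    ultimately show ?thesis by (simp add: pk)
  qed
  then show "integrable M (\<lambda>\<omega>. X \<omega> ^ k)"
    and "(LINT \<omega>|M. X \<omega> ^ 4) = 3 * (LINT \<omega>|M. X \<omega> ^ 2)\<^sup>2" by auto
qed

locale centred_gaussian = prob_space M for M :: "'a measure" +
  fixes Y :: "'i \<Rightarrow> 'a \<Rightarrow> real" and K :: "'i \<Rightarrow> 'i \<Rightarrow> real"
  assumes gauss: "gaussian_field M Y"
    and mean: "(LINT \<omega>|M. Y t \<omega>) = 0"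
    and cov: "(LINT \<omega>|M. Y s \<omega> * Y t \<omega>) = K s t"
begin

definition comb :: "'j set \<Rightarrow> ('j \<Rightarrow> real) \<Rightarrow> ('j \<Rightarrow> 'i) \<Rightarrow> 'a \<Rightarrow> real"
  where "comb J c \<tau> \<omega> = (\<Sum>k\<in>J. c k * Y (\<tau> k) \<omega>)"

lemma gaussian_Y: "gaussian_rv M (Y t)"
proof -
  have "gaussian_rv M (\<lambda>\<omega>. \<Sum>t\<in>{t}. (1::real) * Y t \<omega>)"
    using gauss unfolding gaussian_field_def by (elim conjE allE[of _ "{t}"] allE[of _ "\<lambda>_. 1"]) auto
  then show ?thesis by simp
qed

lemma Y_measurable[measurable]: "Y t \<in> borel_measurable M"
  using gaussian_Y[of t] by (simp add: gaussian_rv_def)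

lemma integrable_Y: "integrable M (Y t)"
  using centred_gaussian_moments(1)[OF gaussian_Y mean, of t 1] by simp

text \<open>The index map may repeat points, whereas the definition of a Gaussian field speaks about
  combinations over sets of distinct points; coefficients of equal points are added up. Repetitions
  do occur once sites are perturbed and combinations are added to each other.\<close>

lemma gaussian_comb:
  assumes J: "finite J"
  shows "gaussian_rv M (comb J c \<tau>)"
proof -
  have "comb J c \<tau> = (\<lambda>\<omega>. \<Sum>t\<in>\<tau> ` J. (\<Sum>k\<in>{k\<in>J. \<tau> k = t}. c k) * Y t \<omega>)"
    unfolding comb_def
    by (rule ext, subst sum.image_gen[OF J, where g=\<tau>]) (auto simp: sum_distrib_right intro!: sum.cong)
  then show ?thesis using gauss J unfolding gaussian_field_def by auto
qed

lemma mean_comb: "(LINT \<omega>|M. comb J c \<tau> \<omega>) = 0"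
  unfolding comb_def by (subst Bochner_Integration.integral_sum) (auto simp: integrable_Y mean)

lemma comb_measurable[measurable]: "comb J c \<tau> \<in> borel_measurable M"
  unfolding comb_def[abs_def] by measurable

lemma integrable_comb_power: "finite J \<Longrightarrow> integrable M (\<lambda>\<omega>. comb J c \<tau> \<omega> ^ k)"
  by (rule centred_gaussian_moments(1)[OF gaussian_comb mean_comb])

lemma integrable_mult_of_squares:
  fixes f g :: "'a \<Rightarrow> real"
  assumes [measurable]: "f \<in> borel_measurable M" "g \<in> borel_measurable M"
    and "integrable M (\<lambda>\<omega>. f \<omega> ^ 2)" "integrable M (\<lambda>\<omega>. g \<omega> ^ 2)"
  shows "integrable M (\<lambda>\<omega>. f \<omega> * g \<omega>)"
proof (rule Bochner_Integration.integrable_bound)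
  show "integrable M (\<lambda>\<omega>. f \<omega> ^ 2 + g \<omega> ^ 2)" using assms by auto
  have "\<bar>a * b\<bar> \<le> a\<^sup>2 + b\<^sup>2" for a b :: real
    using sum_squares_bound[of "\<bar>a\<bar>" "\<bar>b\<bar>"] mult_nonneg_nonneg[of "\<bar>a\<bar>" "\<bar>b\<bar>"]
    unfolding abs_mult power2_abs by linarith
  then show "AE \<omega> in M. norm (f \<omega> * g \<omega>) \<le> norm (f \<omega> ^ 2 + g \<omega> ^ 2)" by auto
qed auto

lemma integrable_YY: "integrable M (\<lambda>\<omega>. Y s \<omega> * Y t \<omega>)"
  by (rule integrable_mult_of_squares) (auto intro: centred_gaussian_moments(1)[OF gaussian_Y mean])

lemma cov_comb:
  "(LINT \<omega>|M. comb J c \<tau> \<omega> * comb J' c' \<tau>' \<omega>) =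
     (\<Sum>a\<in>J. \<Sum>b\<in>J'. c a * c' b * K (\<tau> a) (\<tau>' b))"
proof -
  have "(LINT \<omega>|M. comb J c \<tau> \<omega> * comb J' c' \<tau>' \<omega>) =
     (LINT \<omega>|M. (\<Sum>a\<in>J. \<Sum>b\<in>J'. (c a * c' b) * (Y (\<tau> a) \<omega> * Y (\<tau>' b) \<omega>)))"
    unfolding comb_def by (simp add: sum_product mult_ac)
  also have "\<dots> = (\<Sum>a\<in>J. \<Sum>b\<in>J'. c a * c' b * K (\<tau> a) (\<tau>' b))"
    by (subst Bochner_Integration.integral_sum, (auto intro!: integrable_YY)[1])+
       (auto simp: cov intro!: sum.cong integrable_YY)
  finally show ?thesis .
qed

text \<open>Isserlis' formula for squares. Both \<open>Z + W\<close> and \<open>Z - W\<close> are Gaussian, so their fourth moments are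
  three times the squared variances; polarisation then gives the mixed fourth moment.\<close>

lemma isserlis:
  fixes J :: "'j set" and J' :: "'k set"
    and c c' :: "_ \<Rightarrow> real" and \<tau> \<tau>' :: "_ \<Rightarrow> 'i"
  assumes J: "finite J" "finite J'"
  defines "Z \<equiv> comb J c \<tau>" and "W \<equiv> comb J' c' \<tau>'"
  shows "(LINT \<omega>|M. Z \<omega> ^ 2 * W \<omega> ^ 2) =
    (LINT \<omega>|M. Z \<omega> ^ 2) * (LINT \<omega>|M. W \<omega> ^ 2) + 2 * (LINT \<omega>|M. Z \<omega> * W \<omega>)\<^sup>2"
    and "integrable M (\<lambda>\<omega>. Z \<omega> ^ 2 * W \<omega> ^ 2)"
proof -
  have [measurable]: "Z \<in> borel_measurable M" "W \<in> borel_measurable M" unfolding Z_def W_def by auto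
  have iZ: "integrable M (\<lambda>\<omega>. Z \<omega> ^ k)" and iW: "integrable M (\<lambda>\<omega>. W \<omega> ^ k)" for k
    unfolding Z_def W_def by (auto intro: integrable_comb_power J)
  have sq4: "(x\<^sup>2)\<^sup>2 = x^4" for x :: real by (simp flip: power_mult)
  show i22: "integrable M (\<lambda>\<omega>. Z \<omega> ^ 2 * W \<omega> ^ 2)"
    by (rule integrable_mult_of_squares) (auto simp: sq4 iZ iW)
  have i11: "integrable M (\<lambda>\<omega>. Z \<omega> * W \<omega>)"
    by (rule integrable_mult_of_squares) (auto simp: iZ iW)
  have JJ: "finite (J <+> J')" using J by simp
  have P: "comb (J <+> J') (case_sum c c') (case_sum \<tau> \<tau>') = (\<lambda>\<omega>. Z \<omega> + W \<omega>)"
    unfolding Z_def W_def comb_def using J by (simp add: sum.Plus comp_def)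
  have N: "comb (J <+> J') (case_sum c (\<lambda>k. - c' k)) (case_sum \<tau> \<tau>') = (\<lambda>\<omega>. Z \<omega> - W \<omega>)"
    unfolding Z_def W_def comb_def using J by (simp add: sum.Plus sum_negf comp_def)
  note momP = centred_gaussian_moments[OF gaussian_comb[OF JJ] mean_comb, of "case_sum c c'" "case_sum \<tau> \<tau>'", unfolded P]
  note momN = centred_gaussian_moments[OF gaussian_comb[OF JJ] mean_comb, of "case_sum c (\<lambda>k. - c' k)" "case_sum \<tau> \<tau>'", unfolded N]
  note momZ = centred_gaussian_moments[OF gaussian_comb[OF J(1)] mean_comb, of c \<tau>, folded Z_def]
  note momW = centred_gaussian_moments[OF gaussian_comb[OF J(2)] mean_comb, of c' \<tau>', folded W_def]
  let ?A = "(LINT \<omega>|M. Z \<omega> ^ 2)" and ?B = "(LINT \<omega>|M. W \<omega> ^ 2)" and ?C = "(LINT \<omega>|M. Z \<omega> * W \<omega>)"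
  have P2: "(LINT \<omega>|M. (Z \<omega> + W \<omega>)^2) = ?A + ?B + 2 * ?C"
    using iZ[of 2] iW[of 2] i11 by (simp add: power2_sum mult.assoc)
  have N2: "(LINT \<omega>|M. (Z \<omega> - W \<omega>)^2) = ?A + ?B - 2 * ?C"
    using iZ[of 2] iW[of 2] i11 by (simp add: power2_diff mult.assoc)
  have id: "12 * (Z \<omega> ^ 2 * W \<omega> ^ 2) = (Z \<omega> + W \<omega>)^4 + (Z \<omega> - W \<omega>)^4 - 2 * Z \<omega> ^ 4 - 2 * W \<omega> ^ 4" for \<omega>
    by (simp add: power4_eq_xxxx power2_eq_square algebra_simps)
  have "12 * (LINT \<omega>|M. Z \<omega> ^ 2 * W \<omega> ^ 2) = (LINT \<omega>|M. 12 * (Z \<omega> ^ 2 * W \<omega> ^ 2))" by simp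
  also have "\<dots> = (LINT \<omega>|M. (Z \<omega> + W \<omega>)^4) + (LINT \<omega>|M. (Z \<omega> - W \<omega>)^4)
     - 2 * (LINT \<omega>|M. Z \<omega> ^ 4) - 2 * (LINT \<omega>|M. W \<omega> ^ 4)"
    unfolding id using momP(1)[of 4] momN(1)[of 4] iZ[of 4] iW[of 4] by simp
  also have "\<dots> = 3 * (?A + ?B + 2 * ?C)^2 + 3 * (?A + ?B - 2 * ?C)^2 - 6 * ?A^2 - 6 * ?B^2"
    unfolding momP(2) momN(2) momZ(2) momW(2) P2 N2 by simp
  also have "\<dots> = 12 * (?A * ?B + 2 * ?C\<^sup>2)" by (simp add: power2_eq_square algebra_simps)
  finally show "(LINT \<omega>|M. Z \<omega> ^ 2 * W \<omega> ^ 2) = ?A * ?B + 2 * ?C\<^sup>2" by simp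
qed

end

text \<open>Combinations with common coefficients \<open>c\<close>, located at the sites \<open>\<tau> i\<close>, are squared and summed with
  weights \<open>w\<close>. The moments of this statistic \<open>quad_stat\<close> are expressed through the covariance function
  alone, which makes them accessible to analysis and continuous in the sites.\<close>

definition comb_cov :: "'j set \<Rightarrow> ('j \<Rightarrow> real) \<Rightarrow> ('i \<Rightarrow> 'i \<Rightarrow> real) \<Rightarrow> ('j \<Rightarrow> 'i) \<Rightarrow> ('j \<Rightarrow> 'i) \<Rightarrow> real"
  where "comb_cov J c K \<sigma> \<tau> = (\<Sum>a\<in>J. \<Sum>b\<in>J. c a * c b * K (\<sigma> a) (\<tau> b))"

definition quad_mean :: "'n set \<Rightarrow> ('n \<Rightarrow> real) \<Rightarrow> 'j set \<Rightarrow> ('j \<Rightarrow> real) \<Rightarrow> ('n \<Rightarrow> 'j \<Rightarrow> 'i) \<Rightarrow> ('i \<Rightarrow> 'i \<Rightarrow> real) \<Rightarrow> real"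
  where "quad_mean I w J c \<tau> K = (\<Sum>i\<in>I. w i * comb_cov J c K (\<tau> i) (\<tau> i))"

definition quad_var :: "'n set \<Rightarrow> ('n \<Rightarrow> real) \<Rightarrow> 'j set \<Rightarrow> ('j \<Rightarrow> real) \<Rightarrow> ('n \<Rightarrow> 'j \<Rightarrow> 'i) \<Rightarrow> ('i \<Rightarrow> 'i \<Rightarrow> real) \<Rightarrow> real"
  where "quad_var I w J c \<tau> K = 2 * (\<Sum>i\<in>I. \<Sum>j\<in>I. w i * w j * (comb_cov J c K (\<tau> i) (\<tau> j))\<^sup>2)"

definition quad_stat :: "'n set \<Rightarrow> ('n \<Rightarrow> real) \<Rightarrow> 'j set \<Rightarrow> ('j \<Rightarrow> real) \<Rightarrow> ('n \<Rightarrow> 'j \<Rightarrow> 'i) \<Rightarrow> ('i \<Rightarrow> real) \<Rightarrow> real"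
  where "quad_stat I w J c \<tau> f = (\<Sum>i\<in>I. w i * (\<Sum>a\<in>J. c a * f (\<tau> i a))\<^sup>2)"

context centred_gaussian begin

lemma
  assumes fin: "finite I" "finite J"
  shows mean_quad_stat: "(LINT \<omega>|M. quad_stat I w J c \<tau> (\<lambda>t. Y t \<omega>)) = quad_mean I w J c \<tau> K" (is ?m)
    and variance_quad_stat: "variance (\<lambda>\<omega>. quad_stat I w J c \<tau> (\<lambda>t. Y t \<omega>)) = quad_var I w J c \<tau> K" (is ?v)
    and integrable_quad_stat_square: "integrable M (\<lambda>\<omega>. (quad_stat I w J c \<tau> (\<lambda>t. Y t \<omega>))\<^sup>2)" (is ?i)
    and quad_stat_measurable: "(\<lambda>\<omega>. quad_stat I w J c \<tau> (\<lambda>t. Y t \<omega>)) \<in> borel_measurable M" (is ?b)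
proof -
  have Teq: "quad_stat I w J c \<tau> (\<lambda>t. Y t \<omega>) = (\<Sum>i\<in>I. w i * comb J c (\<tau> i) \<omega> ^ 2)" for \<omega>
    unfolding quad_stat_def comb_def ..
  show ?b unfolding Teq by measurable
  have C: "(LINT \<omega>|M. comb J c (\<tau> i) \<omega> * comb J c (\<tau> j) \<omega>) = comb_cov J c K (\<tau> i) (\<tau> j)" for i j
    unfolding cov_comb comb_cov_def ..
  have C2: "(LINT \<omega>|M. comb J c (\<tau> i) \<omega> ^ 2) = comb_cov J c K (\<tau> i) (\<tau> i)" for i
    using C[of i i] by (simp add: power2_eq_square)
  note ic = integrable_comb_power[OF fin(2)]
  show m: ?m unfolding Teq quad_mean_def by (subst Bochner_Integration.integral_sum) (auto simp: C2 ic)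
  have iT: "integrable M (\<lambda>\<omega>. quad_stat I w J c \<tau> (\<lambda>t. Y t \<omega>))" unfolding Teq by (auto simp: ic)
  note iZW = isserlis(2)[OF fin(2) fin(2)]
  have sq: "(quad_stat I w J c \<tau> (\<lambda>t. Y t \<omega>))\<^sup>2 =
     (\<Sum>i\<in>I. \<Sum>j\<in>I. w i * w j * (comb J c (\<tau> i) \<omega> ^ 2 * comb J c (\<tau> j) \<omega> ^ 2))" for \<omega>
    unfolding Teq power2_eq_square[of "sum _ _"] sum_product by (simp add: mult_ac)
  show i: ?i unfolding sq by (intro Bochner_Integration.integrable_sum integrable_mult_right iZW)
  have "(LINT \<omega>|M. (quad_stat I w J c \<tau> (\<lambda>t. Y t \<omega>))\<^sup>2) =
    (\<Sum>i\<in>I. \<Sum>j\<in>I. w i * w j * (LINT \<omega>|M. comb J c (\<tau> i) \<omega> ^ 2 * comb J c (\<tau> j) \<omega> ^ 2))"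
    unfolding sq
    by (subst Bochner_Integration.integral_sum, (intro Bochner_Integration.integrable_sum integrable_mult_right iZW)[1])+
       (auto intro!: sum.cong)
  also have "\<dots> = (\<Sum>i\<in>I. \<Sum>j\<in>I. (w i * comb_cov J c K (\<tau> i) (\<tau> i)) * (w j * comb_cov J c K (\<tau> j) (\<tau> j)))
     + quad_var I w J c \<tau> K"
    unfolding isserlis(1)[OF fin(2) fin(2)] C C2 quad_var_def sum_distrib_left sum.distrib[symmetric]
    by (simp add: algebra_simps)
  also have "\<dots> = (quad_mean I w J c \<tau> K)\<^sup>2 + quad_var I w J c \<tau> K"
    unfolding quad_mean_def power2_eq_square[of "sum _ _"] sum_product ..
  finally show ?v
    using variance_eq[OF iT i] m by simp
qed

lemma quad_stat_deviation:
  assumes fin: "finite I" "finite J" and d: "d > 0"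
  shows "prob {\<omega>\<in>space M. \<bar>quad_stat I w J c \<tau> (\<lambda>t. Y t \<omega>) - quad_mean I w J c \<tau> K\<bar> \<ge> d} \<le> quad_var I w J c \<tau> K / d\<^sup>2"
  using Chebyshev_inequality[OF quad_stat_measurable[OF fin] integrable_quad_stat_square[OF fin] d]
  unfolding mean_quad_stat[OF fin] variance_quad_stat[OF fin, unfolded mean_quad_stat[OF fin]] .

text \<open>The statistic reads only coordinates in \<open>S\<close>, so it may be evaluated on the law of the field
  restricted to \<open>S\<close>.\<close>

lemma process_law_quad_stat:
  assumes fin: "finite I" "finite J" and S: "\<And>i a. i \<in> I \<Longrightarrow> a \<in> J \<Longrightarrow> \<tau> i a \<in> S"
    and B: "B \<in> sets borel"
  shows "{f \<in> space (\<Pi>\<^sub>M t\<in>S. borel). quad_stat I w J c \<tau> f \<in> B} \<in> sets (\<Pi>\<^sub>M t\<in>S. borel)" (is "?A \<in> _")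
    and "measure (process_law M S Y) {f \<in> space (\<Pi>\<^sub>M t\<in>S. borel). quad_stat I w J c \<tau> f \<in> B} =
      prob {\<omega>\<in>space M. quad_stat I w J c \<tau> (\<lambda>t. Y t \<omega>) \<in> B}"
proof -
  have [measurable]: "(\<lambda>f. f (\<tau> i a)) \<in> borel_measurable (\<Pi>\<^sub>M t\<in>S. borel)" if "i \<in> I" "a \<in> J" for i a
    using S[OF that] by simp
  note [measurable] = B
  show m: "?A \<in> sets (\<Pi>\<^sub>M t\<in>S. borel)" unfolding quad_stat_def by measurable
  have "measure (process_law M S Y) ?A = measure M ((\<lambda>\<omega>. \<lambda>t\<in>S. Y t \<omega>) -` ?A \<inter> space M)"
    unfolding process_law_def by (rule measure_distr) (use m in \<open>auto intro: measurable_restrict\<close>)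
  also have "(\<lambda>\<omega>. \<lambda>t\<in>S. Y t \<omega>) -` ?A \<inter> space M = {\<omega>\<in>space M. quad_stat I w J c \<tau> (\<lambda>t. Y t \<omega>) \<in> B}"
  proof -
    have "quad_stat I w J c \<tau> (\<lambda>t\<in>S. Y t \<omega>) = quad_stat I w J c \<tau> (\<lambda>t. Y t \<omega>)" for \<omega>
      unfolding quad_stat_def using S by (auto intro!: sum.cong arg_cong[where f="\<lambda>x. x\<^sup>2"])
    then show ?thesis by (auto simp: space_PiM)
  qed
  finally show "measure (process_law M S Y) ?A = prob {\<omega>\<in>space M. quad_stat I w J c \<tau> (\<lambda>t. Y t \<omega>) \<in> B}" .
qed

lemma prob_space_process_law: "prob_space (process_law M S Y)"
  unfolding process_law_def by (rule prob_space_distr) (auto intro: measurable_restrict)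

end

lemma space_process_law [simp]: "space (process_law M S Y) = space (\<Pi>\<^sub>M t\<in>S. borel)"
  and sets_process_law [simp]: "sets (process_law M S Y) = sets (\<Pi>\<^sub>M t\<in>S. borel)"
  by (simp_all add: process_law_def)

text \<open>The separating event puts the threshold at distance at least \<open>d\<close> from both means; Chebyshev's
  inequality bounds the two errors.\<close>

lemma quad_stat_separates:
  assumes 1: "centred_gaussian M1 Y1 K1" and 2: "centred_gaussian M2 Y2 K2"
    and fin: "finite I" "finite J" and S: "\<And>i a. i \<in> I \<Longrightarrow> a \<in> J \<Longrightarrow> \<tau> i a \<in> S"
    and d: "d > 0" and gap: "quad_mean I w J c \<tau> K1 - quad_mean I w J c \<tau> K2 \<ge> 2 * d"
    and v: "quad_var I w J c \<tau> K1 \<le> v" "quad_var I w J c \<tau> K2 \<le> v"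
  shows "\<exists>A\<in>sets (\<Pi>\<^sub>M t\<in>S. borel). measure (process_law M1 S Y1) A \<le> v / d\<^sup>2 \<and>
    measure (process_law M2 S Y2) (space (\<Pi>\<^sub>M t\<in>S. borel) - A) \<le> v / d\<^sup>2"
proof -
  interpret G1: centred_gaussian M1 Y1 K1 by fact
  interpret G2: centred_gaussian M2 Y2 K2 by fact
  let ?\<theta> = "quad_mean I w J c \<tau> K2 + d" and ?Q = "quad_stat I w J c \<tau>"
  let ?A = "{f \<in> space (\<Pi>\<^sub>M t\<in>S. borel). ?Q f \<in> {..?\<theta>}}"
  have "measure (process_law M1 S Y1) ?A = G1.prob {\<omega>\<in>space M1. ?Q (\<lambda>t. Y1 t \<omega>) \<in> {..?\<theta>}}"
    by (rule G1.process_law_quad_stat(2)[OF fin S]) auto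
  also have "\<dots> \<le> G1.prob {\<omega>\<in>space M1. \<bar>?Q (\<lambda>t. Y1 t \<omega>) - quad_mean I w J c \<tau> K1\<bar> \<ge> d}"
    using gap d G1.quad_stat_measurable[OF fin, of w c \<tau>]
    by (intro G1.finite_measure_mono) auto
  also have "\<dots> \<le> quad_var I w J c \<tau> K1 / d\<^sup>2" by (rule G1.quad_stat_deviation[OF fin d])
  also have "\<dots> \<le> v / d\<^sup>2" using v by (simp add: divide_right_mono)
  finally have a: "measure (process_law M1 S Y1) ?A \<le> v / d\<^sup>2" .
  have "space (\<Pi>\<^sub>M t\<in>S. borel) - ?A = {f \<in> space (\<Pi>\<^sub>M t\<in>S. borel). ?Q f \<in> {?\<theta><..}}" by auto
  then have "measure (process_law M2 S Y2) (space (\<Pi>\<^sub>M t\<in>S. borel) - ?A) =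
     G2.prob {\<omega>\<in>space M2. ?Q (\<lambda>t. Y2 t \<omega>) \<in> {?\<theta><..}}"
    using G2.process_law_quad_stat(2)[OF fin S, where B = "{?\<theta><..}" and w = w and c = c] by simp
  also have "\<dots> \<le> G2.prob {\<omega>\<in>space M2. \<bar>?Q (\<lambda>t. Y2 t \<omega>) - quad_mean I w J c \<tau> K2\<bar> \<ge> d}"
    using d G2.quad_stat_measurable[OF fin, of w c \<tau>]
    by (intro G2.finite_measure_mono) auto
  also have "\<dots> \<le> quad_var I w J c \<tau> K2 / d\<^sup>2" by (rule G2.quad_stat_deviation[OF fin d])
  also have "\<dots> \<le> v / d\<^sup>2" using v by (simp add: divide_right_mono)
  finally have b: "measure (process_law M2 S Y2) (space (\<Pi>\<^sub>M t\<in>S. borel) - ?A) \<le> v / d\<^sup>2" .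
  have "?A \<in> sets (\<Pi>\<^sub>M t\<in>S. borel)" by (rule G1.process_law_quad_stat(1)[OF fin S]) auto
  then show ?thesis using a b by (rule_tac bexI[of _ ?A]) auto
qed

text \<open>All hypotheses on means and variances are strict inequalities between continuous functions of the
  sites, so they survive a small displacement of the sites from \<open>closure S\<close> into \<open>S\<close>.\<close>

lemma quad_stat_separates_closure:
  fixes \<tau> :: "'n \<Rightarrow> 'j \<Rightarrow> 'i::metric_space"
  assumes 1: "centred_gaussian M1 Y1 K1" and 2: "centred_gaussian M2 Y2 K2"
    and cont: "continuous_on UNIV (\<lambda>(s, t). K1 s t)" "continuous_on UNIV (\<lambda>(s, t). K2 s t)"
    and fin: "finite I" "finite J" and S: "\<And>i a. i \<in> I \<Longrightarrow> a \<in> J \<Longrightarrow> \<tau> i a \<in> closure S"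
    and d: "d > 0" and gap: "quad_mean I w J c \<tau> K1 - quad_mean I w J c \<tau> K2 > 2 * d"
    and v: "quad_var I w J c \<tau> K1 < v" "quad_var I w J c \<tau> K2 < v"
  shows "\<exists>A\<in>sets (\<Pi>\<^sub>M t\<in>S. borel). measure (process_law M1 S Y1) A \<le> v / d\<^sup>2 \<and>
    measure (process_law M2 S Y2) (space (\<Pi>\<^sub>M t\<in>S. borel) - A) \<le> v / d\<^sup>2"
proof -
  have "\<forall>i a. \<exists>x. i \<in> I \<longrightarrow> a \<in> J \<longrightarrow> (\<forall>n. x n \<in> S) \<and> x \<longlonglongrightarrow> \<tau> i a"
    using S by (auto simp: closure_sequential)
  then obtain \<sigma> where \<sigma>: "\<And>i a n. i \<in> I \<Longrightarrow> a \<in> J \<Longrightarrow> \<sigma> i a n \<in> S"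
    and lim: "\<And>i a. i \<in> I \<Longrightarrow> a \<in> J \<Longrightarrow> \<sigma> i a \<longlonglongrightarrow> \<tau> i a" by metis
  have K: "(\<lambda>n. K (\<sigma> i a n) (\<sigma> j b n)) \<longlonglongrightarrow> K (\<tau> i a) (\<tau> j b)"
    if "i \<in> I" "a \<in> J" "j \<in> I" "b \<in> J" and c: "continuous_on UNIV (\<lambda>(s, t). K s t)" for K i a j b
    using continuous_on_tendsto_compose[OF c tendsto_Pair[OF lim[OF that(1,2)] lim[OF that(3,4)]]]
    by simp
  have m: "(\<lambda>n. quad_mean I w J c (\<lambda>i a. \<sigma> i a n) K) \<longlonglongrightarrow> quad_mean I w J c \<tau> K"
    and vv: "(\<lambda>n. quad_var I w J c (\<lambda>i a. \<sigma> i a n) K) \<longlonglongrightarrow> quad_var I w J c \<tau> K"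
    if c: "continuous_on UNIV (\<lambda>(s, t). K s t)" for K
    unfolding quad_mean_def quad_var_def comb_cov_def by (intro tendsto_intros K c; assumption)+
  have "\<forall>\<^sub>F n in sequentially. quad_mean I w J c (\<lambda>i a. \<sigma> i a n) K1 - quad_mean I w J c (\<lambda>i a. \<sigma> i a n) K2 > 2 * d"
    by (rule order_tendstoD(1)[OF tendsto_diff[OF m m] gap]) fact+
  moreover have "\<forall>\<^sub>F n in sequentially. quad_var I w J c (\<lambda>i a. \<sigma> i a n) K1 < v"
    by (rule order_tendstoD(2)[OF vv v(1)]) fact
  moreover have "\<forall>\<^sub>F n in sequentially. quad_var I w J c (\<lambda>i a. \<sigma> i a n) K2 < v"
    by (rule order_tendstoD(2)[OF vv v(2)]) fact
  ultimately have "\<forall>\<^sub>F n in sequentially. quad_mean I w J c (\<lambda>i a. \<sigma> i a n) K1 - quad_mean I w J c (\<lambda>i a. \<sigma> i a n) K2 > 2 * d \<and>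
      quad_var I w J c (\<lambda>i a. \<sigma> i a n) K1 < v \<and> quad_var I w J c (\<lambda>i a. \<sigma> i a n) K2 < v"
    by eventually_elim simp
  then obtain n where "quad_mean I w J c (\<lambda>i a. \<sigma> i a n) K1 - quad_mean I w J c (\<lambda>i a. \<sigma> i a n) K2 > 2 * d"
      "quad_var I w J c (\<lambda>i a. \<sigma> i a n) K1 < v" "quad_var I w J c (\<lambda>i a. \<sigma> i a n) K2 < v"
    by (auto simp: eventually_sequentially)
  then show ?thesis
    by (intro quad_stat_separates[OF 1 2 fin _ d, where \<tau> = "\<lambda>i a. \<sigma> i a n" and w = w and c = c])
       (auto intro: \<sigma>)
qed

section \<open>Finite differences of Gaussian functions\<close>

lemma le_one_plus_square: "y \<le> 1 + y\<^sup>2" for y :: real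
  using zero_le_power2[of "y - 1 / 2"] by (simp add: power2_diff power_divide)

lemma power_times_gauss_bounded: "\<exists>C. \<forall>z::real. \<bar>z ^ n * exp (- z\<^sup>2)\<bar> \<le> C"
proof -
  have "\<bar>z ^ n * exp (- z\<^sup>2)\<bar> \<le> 1 + fact n" for z :: real
  proof -
    have "(\<Sum>k\<in>{n}. (z\<^sup>2) ^ k /\<^sub>R fact k) \<le> exp (z\<^sup>2)"
      unfolding exp_def by (rule sum_le_suminf[OF summable_exp_generic]) auto
    then have 1: "(z\<^sup>2) ^ n \<le> fact n * exp (z\<^sup>2)" by (simp add: field_simps)
    have "\<bar>z\<bar> ^ n \<le> 1 + (\<bar>z\<bar> ^ n)\<^sup>2"
      by (rule le_one_plus_square)
    also have "(\<bar>z\<bar> ^ n)\<^sup>2 = (z\<^sup>2) ^ n" by (metis power2_abs power_mult mult.commute)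
    also have "1 + (z\<^sup>2) ^ n \<le> exp (z\<^sup>2) + fact n * exp (z\<^sup>2)" using 1 by (intro add_mono) auto
    finally have "\<bar>z\<bar> ^ n \<le> (1 + fact n) * exp (z\<^sup>2)" by (simp add: algebra_simps)
    then show ?thesis by (simp add: abs_mult power_abs exp_minus divide_simps)
  qed
  then show ?thesis by blast
qed

lemma poly_times_gauss_bounded: "\<exists>C. \<forall>z::real. \<bar>poly q z * exp (- z\<^sup>2)\<bar> \<le> C"
proof -
  obtain C where C: "\<And>n z. \<bar>(z::real) ^ n * exp (- z\<^sup>2)\<bar> \<le> C n"
    using power_times_gauss_bounded by metis
  have "\<bar>poly q z * exp (- z\<^sup>2)\<bar> \<le> (\<Sum>i\<le>degree q. \<bar>coeff q i\<bar> * C i)" for z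
  proof -
    have "poly q z * exp (- z\<^sup>2) = (\<Sum>i\<le>degree q. coeff q i * (z ^ i * exp (- z\<^sup>2)))"
      unfolding poly_altdef sum_distrib_right by (simp add: mult_ac)
    also have "\<bar>\<dots>\<bar> \<le> (\<Sum>i\<le>degree q. \<bar>coeff q i * (z ^ i * exp (- z\<^sup>2))\<bar>)" by (rule sum_abs)
    also have "\<dots> \<le> (\<Sum>i\<le>degree q. \<bar>coeff q i\<bar> * C i)"
      unfolding abs_mult[of "coeff q _"] by (intro sum_mono mult_left_mono C) auto
    finally show ?thesis .
  qed
  then show ?thesis by blast
qed

text \<open>Derivatives of \<open>exp (- z\<^sup>2)\<close> are polynomial multiples of it; these are the Hermite polynomials up to
  sign.\<close>

fun hermite :: "nat \<Rightarrow> real poly" where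
  "hermite 0 = 1"
| "hermite (Suc n) = pderiv (hermite n) - [:0, 2:] * hermite n"

lemma DERIV_hermite_gauss:
  "((\<lambda>z. poly (hermite n) z * exp (- z\<^sup>2)) has_real_derivative poly (hermite (Suc n)) z * exp (- z\<^sup>2)) (at z)"
  by (auto intro!: derivative_eq_intros simp: algebra_simps)

text \<open>Coefficients of the \<open>p\<close>-th finite difference, up to the sign \<open>(-1) ^ p\<close>.\<close>

definition diff_coeff :: "nat \<Rightarrow> nat \<Rightarrow> real" where "diff_coeff p a = (-1) ^ a * real (p choose a)"

lemma sum_diff_coeff_Suc:
  "(\<Sum>a\<le>Suc p. diff_coeff (Suc p) a * f a) = (\<Sum>a\<le>p. diff_coeff p a * (f a - f (Suc a)))"
proof -
  have 0: "diff_coeff (Suc p) (Suc a) = diff_coeff p (Suc a) - diff_coeff p a" for a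
    by (simp add: diff_coeff_def algebra_simps)
  have z: "diff_coeff p (Suc p) = 0" "diff_coeff p 0 = 1" "diff_coeff (Suc p) 0 = 1" by (simp_all add: diff_coeff_def)
  have "(\<Sum>a\<le>Suc p. diff_coeff (Suc p) a * f a) = f 0 + (\<Sum>a\<le>p. diff_coeff (Suc p) (Suc a) * f (Suc a))"
    by (subst sum.atMost_Suc_shift) (simp add: z)
  also have "\<dots> = (f 0 + (\<Sum>a\<le>p. diff_coeff p (Suc a) * f (Suc a))) - (\<Sum>a\<le>p. diff_coeff p a * f (Suc a))"
    unfolding 0 by (simp add: left_diff_distrib sum_subtractf)
  also have "f 0 + (\<Sum>a\<le>p. diff_coeff p (Suc a) * f (Suc a)) = (\<Sum>a\<le>Suc p. diff_coeff p a * f a)"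
    by (subst sum.atMost_Suc_shift) (simp add: z)
  also have "\<dots> = (\<Sum>a\<le>p. diff_coeff p a * f a)" by (simp add: z)
  finally show ?thesis by (simp add: right_diff_distrib sum_subtractf)
qed

text \<open>Mean value theorem for finite differences. In the inductive step the difference of order \<open>p + 1\<close> of
  \<open>D 0\<close> is the difference of order \<open>p\<close> of \<open>\<lambda>x. D 0 x - D 0 (x + \<delta>)\<close>.\<close>

lemma finite_difference_mvt:
  fixes D :: "nat \<Rightarrow> real \<Rightarrow> real"
  assumes "\<And>n x. (D n has_real_derivative D (Suc n) x) (at x)" and "\<delta> > 0"
  shows "\<exists>\<xi>\<in>{x..x + real p * \<delta>}. \<bar>\<Sum>a\<le>p. diff_coeff p a * D 0 (x + real a * \<delta>)\<bar> = \<delta> ^ p * \<bar>D p \<xi>\<bar>"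
  using assms
proof (induction p arbitrary: D)
  case 0
  then show ?case by (simp add: diff_coeff_def)
next
  case (Suc p)
  let ?E = "\<lambda>n x. D n x - D n (x + \<delta>)"
  have "(?E n has_real_derivative ?E (Suc n) x) (at x)" for n x
    using Suc.prems(1)[of n "x + \<delta>"] unfolding DERIV_shift by (rule DERIV_diff[OF Suc.prems(1)])
  from Suc.IH[of ?E, OF this Suc.prems(2)] obtain \<xi> where \<xi>: "\<xi> \<in> {x..x + real p * \<delta>}"
    "\<bar>\<Sum>a\<le>p. diff_coeff p a * ?E 0 (x + real a * \<delta>)\<bar> = \<delta> ^ p * \<bar>?E p \<xi>\<bar>" by blast
  obtain z where z: "\<xi> < z" "z < \<xi> + \<delta>" "D p (\<xi> + \<delta>) - D p \<xi> = (\<xi> + \<delta> - \<xi>) * D (Suc p) z"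
    using MVT2[of \<xi> "\<xi> + \<delta>" "D p" "D (Suc p)"] Suc.prems by auto
  have "?E p \<xi> = - (\<delta> * D (Suc p) z)" using z(3) by simp
  then have "\<bar>?E p \<xi>\<bar> = \<delta> * \<bar>D (Suc p) z\<bar>" using Suc.prems(2) by (simp add: abs_mult)
  moreover have "(\<Sum>a\<le>Suc p. diff_coeff (Suc p) a * D 0 (x + real a * \<delta>)) = (\<Sum>a\<le>p. diff_coeff p a * ?E 0 (x + real a * \<delta>))"
    unfolding sum_diff_coeff_Suc by (simp add: algebra_simps)
  ultimately have "\<bar>\<Sum>a\<le>Suc p. diff_coeff (Suc p) a * D 0 (x + real a * \<delta>)\<bar> = \<delta> ^ Suc p * \<bar>D (Suc p) z\<bar>"
    using \<xi>(2) by simp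
  moreover have "z \<in> {x..x + real (Suc p) * \<delta>}" using \<xi>(1) z by (auto simp: algebra_simps)
  ultimately show ?case by blast
qed

lemma weighted_gauss_le:
  assumes "\<rho> > 0" shows "(1 + \<bar>x\<bar>) * exp (- (x / \<rho>)\<^sup>2) \<le> 1 + (\<rho>::real)"
proof -
  let ?y = "\<bar>x\<bar> / \<rho>"
  have "?y \<le> 1 + ?y\<^sup>2" by (rule le_one_plus_square)
  also have "\<dots> \<le> exp (?y\<^sup>2)" by (rule exp_ge_add_one_self)
  finally have "?y * exp (- ?y\<^sup>2) \<le> exp (?y\<^sup>2) * exp (- ?y\<^sup>2)" by (intro mult_right_mono) auto
  also have "\<dots> = 1" by (simp flip: exp_add)
  finally have "?y * exp (- ?y\<^sup>2) \<le> 1" .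
  then have "\<rho> * (?y * exp (- ?y\<^sup>2)) \<le> \<rho> * 1" using assms by (intro mult_left_mono) auto
  then have 1: "\<bar>x\<bar> * exp (- (x / \<rho>)\<^sup>2) \<le> \<rho>" using assms by (simp add: power_divide)
  have "exp (- (x / \<rho>)\<^sup>2) \<le> 1" by simp
  with 1 show ?thesis by (simp only: distrib_right mult_1_left)
qed

text \<open>For widths \<open>\<rho> \<ge> 1\<close> every difference of step one gains a factor \<open>1 / \<rho>\<close>, by the mean value theorem
  applied after rescaling to unit width. For \<open>\<rho> < 1\<close> no gain is needed and each term is bounded
  separately. The weight \<open>1 + \<bar>x\<bar>\<close> costs a factor \<open>1 + \<rho>\<close>.\<close>

lemma weighted_gauss_difference_le:
  "\<exists>C. C \<ge> 0 \<and> (\<forall>\<rho>>0. \<forall>x. (1 + \<bar>x\<bar>) * \<bar>\<Sum>a\<le>p. diff_coeff p a * exp (- ((x + real a) / \<rho>)\<^sup>2)\<bar> \<le> C * (1 + \<rho>) / (1 + \<rho>) ^ p)"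
proof -
  let ?H = "\<lambda>n z. poly (hermite n) z * exp (- z\<^sup>2)"
  obtain C0 where C0: "\<And>z. \<bar>?H p z\<bar> \<le> C0" using poly_times_gauss_bounded by blast
  obtain C1 where C1: "\<And>z. \<bar>poly ([:0, 1:] * hermite p) z * exp (- z\<^sup>2)\<bar> \<le> C1"
    using poly_times_gauss_bounded by blast
  have pos: "C0 \<ge> 0" "C1 \<ge> 0" using C0[of 0] C1[of 0] by (auto intro: order_trans[OF abs_ge_zero])
  define A where "A = (\<Sum>a\<le>p. \<bar>diff_coeff p a\<bar> * (1 + real a))"
  have A: "A \<ge> 0" unfolding A_def by (intro sum_nonneg) auto
  \<comment> \<open>\<open>2 ^ p\<close> accounts for replacing \<open>\<rho>\<close> by \<open>1 + \<rho>\<close>, respectively \<open>1\<close> by \<open>1 + \<rho>\<close>, in the denominator\<close>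
  define C where "C = 2 ^ p * (C0 * (1 + p) + C1 + A)"
  have "(1 + \<bar>x\<bar>) * \<bar>\<Sum>a\<le>p. diff_coeff p a * exp (- ((x + real a) / \<rho>)\<^sup>2)\<bar> \<le> C * (1 + \<rho>) / (1 + \<rho>) ^ p"
    if l: "\<rho> > 0" for \<rho> x :: real
  proof (cases "\<rho> \<ge> 1")
    case True
    obtain \<xi> where \<xi>: "\<xi> \<in> {x / \<rho>..x / \<rho> + real p * (1 / \<rho>)}"
      "\<bar>\<Sum>a\<le>p. diff_coeff p a * ?H 0 (x / \<rho> + real a * (1 / \<rho>))\<bar> = (1 / \<rho>) ^ p * \<bar>?H p \<xi>\<bar>"
      using finite_difference_mvt[of ?H "1 / \<rho>" "x / \<rho>" p, OF DERIV_hermite_gauss] l by auto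
    have eq: "\<bar>\<Sum>a\<le>p. diff_coeff p a * exp (- ((x + real a) / \<rho>)\<^sup>2)\<bar> = (1 / \<rho>) ^ p * \<bar>?H p \<xi>\<bar>"
      using \<xi>(2) by (simp add: add_divide_distrib)
    have "x \<le> \<rho> * \<xi>" "\<rho> * \<xi> \<le> x + p" using \<xi>(1) l by (auto simp: field_simps)
    then have "\<bar>x\<bar> \<le> p + \<bar>\<rho> * \<xi>\<bar>" by linarith
    then have "(1 + \<bar>x\<bar>) * \<bar>?H p \<xi>\<bar> \<le> (1 + p + \<rho> * \<bar>\<xi>\<bar>) * \<bar>?H p \<xi>\<bar>"
      using l by (intro mult_right_mono) (auto simp: abs_mult)
    also have "\<dots> = (1 + p) * \<bar>?H p \<xi>\<bar> + \<rho> * \<bar>poly ([:0, 1:] * hermite p) \<xi> * exp (- \<xi>\<^sup>2)\<bar>"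
      by (simp add: algebra_simps abs_mult)
    also have "\<dots> \<le> (1 + p) * C0 + \<rho> * C1" by (intro add_mono mult_left_mono C0 C1) (use l in auto)
    also have "\<dots> \<le> (C0 * (1 + p) + C1 + A) * (1 + \<rho>)"
      using pos A l by (simp add: algebra_simps)
    finally have b: "(1 + \<bar>x\<bar>) * \<bar>?H p \<xi>\<bar> \<le> (C0 * (1 + p) + C1 + A) * (1 + \<rho>)" .
    have "(1 / \<rho>) ^ p \<le> (2 / (1 + \<rho>)) ^ p"
      by (intro power_mono) (use True in \<open>auto simp: field_simps\<close>)
    from mult_mono[OF this b] have "(1 / \<rho>) ^ p * ((1 + \<bar>x\<bar>) * \<bar>?H p \<xi>\<bar>) \<le> (2 / (1 + \<rho>)) ^ p * ((C0 * (1 + p) + C1 + A) * (1 + \<rho>))"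
      using l by simp
    then show ?thesis unfolding eq C_def by (simp add: power_divide mult_ac)
  next
    case False
    have "(1 + \<bar>x\<bar>) * \<bar>\<Sum>a\<le>p. diff_coeff p a * exp (- ((x + real a) / \<rho>)\<^sup>2)\<bar>
       \<le> (1 + \<bar>x\<bar>) * (\<Sum>a\<le>p. \<bar>diff_coeff p a\<bar> * exp (- ((x + real a) / \<rho>)\<^sup>2))"
      by (intro mult_left_mono order_trans[OF sum_abs]) (auto simp: abs_mult)
    also have "\<dots> = (\<Sum>a\<le>p. \<bar>diff_coeff p a\<bar> * ((1 + \<bar>x\<bar>) * exp (- ((x + real a) / \<rho>)\<^sup>2)))"
      by (simp add: sum_distrib_left mult_ac)
    also have "\<dots> \<le> (\<Sum>a\<le>p. \<bar>diff_coeff p a\<bar> * ((1 + real a) * (1 + \<rho>)))"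
    proof (intro sum_mono mult_left_mono)
      fix a
      have "1 + \<bar>x\<bar> \<le> (1 + real a) + \<bar>x + real a\<bar>" by simp
      also have "\<dots> \<le> (1 + real a) * (1 + \<bar>x + real a\<bar>)" by (simp add: algebra_simps)
      finally have "(1 + \<bar>x\<bar>) * exp (- ((x + real a) / \<rho>)\<^sup>2)
        \<le> (1 + real a) * ((1 + \<bar>x + real a\<bar>) * exp (- ((x + real a) / \<rho>)\<^sup>2))"
        by (metis exp_ge_zero mult.assoc mult_right_mono)
      also have "\<dots> \<le> (1 + real a) * (1 + \<rho>)" by (intro mult_left_mono weighted_gauss_le l) auto
      finally show "(1 + \<bar>x\<bar>) * exp (- ((x + real a) / \<rho>)\<^sup>2) \<le> (1 + real a) * (1 + \<rho>)" .
    qed auto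
    also have "\<dots> = A * (1 + \<rho>)" unfolding A_def sum_distrib_right by (simp add: mult_ac)
    also have "\<dots> \<le> (2 / (1 + \<rho>)) ^ p * ((C0 * (1 + p) + C1 + A) * (1 + \<rho>))"
    proof -
      have "1 \<le> (2 / (1 + \<rho>)) ^ p" using False l by (intro one_le_power) (auto simp: field_simps)
      moreover have "A * (1 + \<rho>) \<le> (C0 * (1 + p) + C1 + A) * (1 + \<rho>)"
        using pos l by (intro mult_right_mono) auto
      moreover have "0 \<le> A * (1 + \<rho>)" using A l by auto
      ultimately show ?thesis
        using mult_mono[of 1 "(2 / (1 + \<rho>)) ^ p" "A * (1 + \<rho>)"] by simp
    qed
    finally show ?thesis unfolding C_def by (simp add: power_divide mult_ac)
  qed
  moreover have "C \<ge> 0" unfolding C_def using pos A by simp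
  ultimately show ?thesis by blast
qed

lemma gauss_prod:
  fixes u :: "real^'n" shows "exp (- (norm u / \<rho>)\<^sup>2) = (\<Prod>i\<in>UNIV. exp (- (u $ i / \<rho>)\<^sup>2))"
proof -
  have "(norm u / \<rho>)\<^sup>2 = (\<Sum>i\<in>UNIV. (u $ i / \<rho>)\<^sup>2)"
    by (simp add: power_divide norm_vec_def L2_set_def sum_nonneg sum_divide_distrib)
  then show ?thesis by (simp add: exp_sum sum_negf[symmetric])
qed

abbreviation e1 :: "real^4" where "e1 \<equiv> axis 1 1"

text \<open>A Gaussian function of the Euclidean norm is a product over coordinates. Differencing acts on the
  first factor only, the others contribute decay; the four weights cost \<open>(1 + \<rho>) ^ 4\<close> in total.\<close>

lemma weighted_gauss_difference_vec_le:
  "\<exists>C. C \<ge> 0 \<and> (\<forall>\<rho>>0. \<forall>u::real^4.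
     (\<Prod>i\<in>UNIV. 1 + \<bar>u $ i\<bar>) * \<bar>\<Sum>a\<le>p. diff_coeff p a * exp (- (norm (u + real a *\<^sub>R e1) / \<rho>)\<^sup>2)\<bar>
       \<le> C * (1 + \<rho>) ^ 4 / (1 + \<rho>) ^ p)"
proof -
  obtain C where C: "C \<ge> 0" "\<And>\<rho> x. \<rho> > 0 \<Longrightarrow>
      (1 + \<bar>x\<bar>) * \<bar>\<Sum>a\<le>p. diff_coeff p a * exp (- ((x + real a) / \<rho>)\<^sup>2)\<bar> \<le> C * (1 + \<rho>) / (1 + \<rho>) ^ p"
    using weighted_gauss_difference_le by blast
  have "(\<Prod>i\<in>UNIV. 1 + \<bar>u $ i\<bar>) * \<bar>\<Sum>a\<le>p. diff_coeff p a * exp (- (norm (u + real a *\<^sub>R e1) / \<rho>)\<^sup>2)\<bar>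
       \<le> C * (1 + \<rho>) ^ 4 / (1 + \<rho>) ^ p" if l: "\<rho> > 0" for \<rho> and u :: "real^4"
  proof -
    let ?R = "UNIV - {1 :: 4}"
    let ?g = "\<lambda>x. exp (- (x / \<rho>)\<^sup>2)"
    have split: "(\<Prod>i\<in>UNIV. f i) = f 1 * (\<Prod>i\<in>?R. f i)" for f :: "4 \<Rightarrow> real"
      by (rule prod.remove) auto
    have "?g (norm (u + real a *\<^sub>R e1)) = ?g (u $ 1 + real a) * (\<Prod>i\<in>?R. ?g (u $ i))" for a
    proof -
      have "(\<Prod>i\<in>?R. ?g ((u + real a *\<^sub>R e1) $ i)) = (\<Prod>i\<in>?R. ?g (u $ i))"
        by (intro prod.cong) (auto simp: axis_def)
      then show ?thesis unfolding gauss_prod split by (simp add: axis_def)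
    qed
    then have "(\<Sum>a\<le>p. diff_coeff p a * ?g (norm (u + real a *\<^sub>R e1)))
      = (\<Sum>a\<le>p. diff_coeff p a * ?g (u $ 1 + real a)) * (\<Prod>i\<in>?R. ?g (u $ i))"
      by (simp add: sum_distrib_right mult.assoc)
    then have "(\<Prod>i\<in>UNIV. 1 + \<bar>u $ i\<bar>) * \<bar>\<Sum>a\<le>p. diff_coeff p a * ?g (norm (u + real a *\<^sub>R e1))\<bar>
      = ((1 + \<bar>u $ 1\<bar>) * \<bar>\<Sum>a\<le>p. diff_coeff p a * ?g (u $ 1 + real a)\<bar>) * (\<Prod>i\<in>?R. (1 + \<bar>u $ i\<bar>) * ?g (u $ i))"
      unfolding split by (simp add: abs_mult abs_prod prod.distrib mult_ac)
    also have "\<dots> \<le> (C * (1 + \<rho>) / (1 + \<rho>) ^ p) * (\<Prod>i\<in>?R. 1 + \<rho>)"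
      by (intro mult_mono C prod_mono conjI weighted_gauss_le l prod_nonneg) (use l C(1) in auto)
    also have "(\<Prod>i\<in>?R. 1 + \<rho>) = (1 + \<rho>) ^ 3" by (simp add: card_Diff_singleton)
    finally show ?thesis by (simp add: eval_nat_numeral mult_ac)
  qed
  with C(1) show ?thesis by blast
qed

section \<open>The Matern covariance as a mixture of Gaussian functions\<close>

lemma integrable_exp_abs:
  assumes c: "c > 0" shows "integrable lborel (\<lambda>t::real. exp (- c * \<bar>t\<bar>))"
proof -
  interpret prob_space "density lborel (exponential_density c)"
    by (rule prob_space_exponential_density[OF c])
  have "integrable (density lborel (exponential_density c)) (\<lambda>_. 1 :: real)" by simp
  then have i: "integrable lborel (exponential_density c)"
    by (subst (asm) integrable_density) (auto simp: exponential_density_def[abs_def] c less_imp_le)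
  then have i': "integrable lborel (\<lambda>t. exponential_density c (- t))"
    using lborel_integrable_real_affine[OF i, of "-1" 0] by simp
  show ?thesis
  proof (rule Bochner_Integration.integrable_bound)
    show "integrable lborel (\<lambda>t. (1 / c) * (exponential_density c t + exponential_density c (- t)))"
      using i i' by simp
    show "AE t in lborel. norm (exp (- c * \<bar>t\<bar>)) \<le> norm ((1 / c) * (exponential_density c t + exponential_density c (- t)))"
      using c by (intro AE_I2) (auto simp: exponential_density_def abs_if mult.commute)
  qed simp
qed

text \<open>The factor \<open>exp (2 \<nu> t)\<close> is integrable at \<open>-\<infinity>\<close>; at \<open>\<infinity>\<close> a power of \<open>1 + exp t\<close> of order twice
  its growth rate in the denominator makes the bound symmetric in \<open>t\<close>.\<close>

lemma exp_weight_le: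
  fixes \<nu> :: real
  assumes "\<nu> > 0" "real m \<ge> 4 * \<nu>"
  shows "exp (2 * \<nu> * t) / (1 + exp t) ^ m \<le> exp (- (2 * \<nu>) * \<bar>t\<bar>)"
proof (cases "t \<ge> 0")
  case True
  have "exp (4 * \<nu> * t) \<le> exp (real m * t)" using assms True by (simp add: mult_right_mono)
  also have "\<dots> = exp t ^ m" by (rule exp_of_nat_mult)
  also have "\<dots> \<le> (1 + exp t) ^ m" by (intro power_mono) auto
  finally have "exp (4 * \<nu> * t) * exp (- (2 * \<nu>) * t) \<le> (1 + exp t) ^ m * exp (- (2 * \<nu>) * t)"
    by (rule mult_right_mono) simp
  then have "exp (2 * \<nu> * t) \<le> (1 + exp t) ^ m * exp (- (2 * \<nu>) * t)"
    by (simp flip: exp_add add: algebra_simps)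
  moreover have pos: "(1 + exp t) ^ m > 0" by (rule zero_less_power) (rule add_pos_pos; simp)
  ultimately show ?thesis using True unfolding pos_divide_le_eq[OF pos] by (simp add: mult.commute)
next
  case False
  have "1 \<le> (1 + exp t) ^ m" by (intro one_le_power) auto
  then have "exp (2 * \<nu> * t) / (1 + exp t) ^ m \<le> exp (2 * \<nu> * t) / 1"
    by (intro divide_left_mono) (auto intro!: zero_less_power add_pos_pos)
  then show ?thesis using False by simp
qed

lemma gauss_le_inverse_power:
  fixes \<beta> :: real assumes b: "\<beta> > 0"
  shows "\<exists>C\<ge>0. \<forall>y\<ge>0. exp (- \<beta> * y\<^sup>2) \<le> C / (1 + y) ^ m"
proof -
  obtain C where C: "\<And>z. \<bar>poly ([:1, 1 / sqrt \<beta>:] ^ m) z * exp (- z\<^sup>2)\<bar> \<le> C"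
    using poly_times_gauss_bounded by blast
  have "exp (- \<beta> * y\<^sup>2) \<le> C / (1 + y) ^ m" if y: "y \<ge> 0" for y
  proof -
    have "(1 + y) ^ m * exp (- \<beta> * y\<^sup>2) \<le> C"
      using C[of "sqrt \<beta> * y"] b y by (simp add: poly_power power_mult_distrib)
    then show ?thesis using y by (subst pos_le_divide_eq) (auto simp: mult.commute)
  qed
  moreover have "C \<ge> 0" using C[of 0] by (rule order_trans[OF abs_ge_zero])
  ultimately show ?thesis by blast
qed

text \<open>The mixture is parametrised by the logarithm \<open>t\<close> of the width of the Gaussian function. A change of
  scale then becomes a translation of \<open>t\<close>.\<close>

definition mixture_integrand :: "real \<Rightarrow> real \<Rightarrow> real \<Rightarrow> real \<Rightarrow> real" where
  "mixture_integrand \<nu> \<beta> r t = exp (2 * \<nu> * t) * exp (- \<beta> * (exp t)\<^sup>2) * exp (- (r / exp t)\<^sup>2)"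

definition mixture :: "real \<Rightarrow> real \<Rightarrow> real \<Rightarrow> real" where
  "mixture \<nu> \<beta> r = (LINT t|lborel. mixture_integrand \<nu> \<beta> r t)"

lemma mixture_integrand_measurable [measurable]: "mixture_integrand \<nu> \<beta> r \<in> borel_measurable lborel"
  unfolding mixture_integrand_def[abs_def] by measurable

lemma mixture_integrand_le_0: "mixture_integrand \<nu> \<beta> r t \<le> mixture_integrand \<nu> \<beta> 0 t"
  unfolding mixture_integrand_def by (intro mult_left_mono) auto

lemma mixture_integrand_nonneg: "0 \<le> mixture_integrand \<nu> \<beta> r t"
  unfolding mixture_integrand_def by auto

lemma integrable_mixture:
  assumes "\<nu> > 0" "\<beta> > 0" shows "integrable lborel (mixture_integrand \<nu> \<beta> r)"
proof -
  define m where "m = nat \<lceil>4 * \<nu>\<rceil>"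
  have m: "real m \<ge> 4 * \<nu>" unfolding m_def by linarith
  obtain C where C: "C \<ge> 0" "\<And>y. y \<ge> 0 \<Longrightarrow> exp (- \<beta> * y\<^sup>2) \<le> C / (1 + y) ^ m"
    using gauss_le_inverse_power[OF assms(2)] by blast
  show ?thesis
  proof (rule Bochner_Integration.integrable_bound)
    show "integrable lborel (\<lambda>t. C * exp (- (2 * \<nu>) * \<bar>t\<bar>))"
      using integrable_exp_abs[of "2 * \<nu>"] assms by simp
    have "norm (mixture_integrand \<nu> \<beta> r t) \<le> norm (C * exp (- (2 * \<nu>) * \<bar>t\<bar>))" for t
    proof -
      have "mixture_integrand \<nu> \<beta> r t \<le> exp (2 * \<nu> * t) * (C / (1 + exp t) ^ m)"
      proof (rule order_trans[OF mixture_integrand_le_0])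
        have "exp (2 * \<nu> * t) * exp (- \<beta> * (exp t)\<^sup>2) \<le> exp (2 * \<nu> * t) * (C / (1 + exp t) ^ m)"
          using C(2)[of "exp t"] by (intro mult_left_mono) auto
        then show "mixture_integrand \<nu> \<beta> 0 t \<le> exp (2 * \<nu> * t) * (C / (1 + exp t) ^ m)"
          by (simp add: mixture_integrand_def)
      qed
      also have "\<dots> = C * (exp (2 * \<nu> * t) / (1 + exp t) ^ m)" by simp
      also have "\<dots> \<le> C * exp (- (2 * \<nu>) * \<bar>t\<bar>)"
        by (intro mult_left_mono exp_weight_le assms m C)
      finally show ?thesis using C(1) mixture_integrand_nonneg[of \<nu> \<beta> r t] by simp
    qed
    then show "AE t in lborel. norm (mixture_integrand \<nu> \<beta> r t) \<le> norm (C * exp (- (2 * \<nu>) * \<bar>t\<bar>))" by simp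
  qed simp
qed

lemma continuous_mixture:
  assumes "\<nu> > 0" "\<beta> > 0" shows "continuous_on UNIV (mixture \<nu> \<beta>)"
  unfolding continuous_on_sequentially comp_def
proof safe
  fix x :: "nat \<Rightarrow> real" and a assume x: "x \<longlonglongrightarrow> a"
  show "(\<lambda>n. mixture \<nu> \<beta> (x n)) \<longlonglongrightarrow> mixture \<nu> \<beta> a"
    unfolding mixture_def
  proof (rule integral_dominated_convergence[where w = "mixture_integrand \<nu> \<beta> 0"])
    show "AE t in lborel. (\<lambda>n. mixture_integrand \<nu> \<beta> (x n) t) \<longlonglongrightarrow> mixture_integrand \<nu> \<beta> a t"
      unfolding mixture_integrand_def by (intro AE_I2 tendsto_intros x) auto
    show "AE t in lborel. norm (mixture_integrand \<nu> \<beta> (x n) t) \<le> mixture_integrand \<nu> \<beta> 0 t" for n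
      using mixture_integrand_le_0 mixture_integrand_nonneg by auto
  qed (auto intro: integrable_mixture assms)
qed

text \<open>Rescaling the lag by \<open>h\<close> produces the power \<open>h powr (2 \<nu>)\<close> and replaces \<open>\<beta>\<close> by \<open>\<beta> h\<^sup>2\<close>.
  This is why increments of small step depend on \<open>\<beta>\<close> only at relative order \<open>h\<^sup>2\<close>.\<close>

lemma mixture_scale:
  assumes h: "h > 0" shows "mixture \<nu> \<beta> (h * r) = h powr (2 * \<nu>) * mixture \<nu> (\<beta> * h\<^sup>2) r"
proof -
  have "mixture \<nu> \<beta> (h * r) = (LINT t|lborel. mixture_integrand \<nu> \<beta> (h * r) (ln h + 1 * t))"
    unfolding mixture_def by (subst lborel_integral_real_affine[where c=1 and t="ln h"]) auto
  also have "\<dots> = (LINT t|lborel. h powr (2 * \<nu>) * mixture_integrand \<nu> (\<beta> * h\<^sup>2) r t)"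
  proof (rule Bochner_Integration.integral_cong[OF refl])
    fix t
    have e: "exp (ln h + 1 * t) = h * exp t" using h by (simp add: exp_add)
    have w: "exp (2 * \<nu> * (ln h + 1 * t)) = h powr (2 * \<nu>) * exp (2 * \<nu> * t)"
      using h by (simp add: powr_def exp_add[symmetric] algebra_simps)
    show "mixture_integrand \<nu> \<beta> (h * r) (ln h + 1 * t) = h powr (2 * \<nu>) * mixture_integrand \<nu> (\<beta> * h\<^sup>2) r t"
      unfolding mixture_integrand_def e w using h by (simp add: power_mult_distrib mult_ac)
  qed
  finally show ?thesis by (simp add: mixture_def)
qed

text \<open>For a field with covariance \<open>mixture\<close> of the distance, this is the covariance of an increment of order
  \<open>p\<close> and step \<open>h\<close> with a single value of the field, where \<open>u\<close> is their lag in units of \<open>h\<close>.\<close>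

definition mixture_diff :: "nat \<Rightarrow> real \<Rightarrow> real \<Rightarrow> real \<Rightarrow> real^4 \<Rightarrow> real" where
  "mixture_diff p \<nu> \<beta> h u = (\<Sum>b\<le>p. diff_coeff p b * mixture \<nu> \<beta> (norm (h *\<^sub>R (u + real b *\<^sub>R e1))))"

text \<open>After rescaling, the factor containing \<open>\<beta>\<close> is at most one, so the constant depends neither on \<open>\<beta>\<close>
  nor on the step. The order \<open>p\<close> pays for the four weights and for the growth of
  \<open>exp (2 \<nu> t)\<close>.\<close>

lemma mixture_diff_decay:
  assumes nu: "\<nu> > 0" and p: "real p \<ge> 4 + 4 * \<nu>"
  shows "\<exists>C\<ge>0. \<forall>\<beta>>0. \<forall>h>0. \<forall>u. \<bar>mixture_diff p \<nu> \<beta> h u\<bar> \<le> h powr (2 * \<nu>) * C / (\<Prod>i\<in>UNIV. 1 + \<bar>u $ i\<bar>)"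
proof -
  obtain C where C: "C \<ge> 0" and le: "\<And>\<rho> u. \<rho> > 0 \<Longrightarrow>
     (\<Prod>i\<in>UNIV. 1 + \<bar>u $ i\<bar>) * \<bar>\<Sum>a\<le>p. diff_coeff p a * exp (- (norm (u + real a *\<^sub>R e1) / \<rho>)\<^sup>2)\<bar>
       \<le> C * (1 + \<rho>) ^ 4 / (1 + \<rho>) ^ p"
    using weighted_gauss_difference_vec_le by blast
  define A where "A = (LINT t|lborel. exp (- (2 * \<nu>) * \<bar>t\<bar>))"
  have A: "A \<ge> 0" unfolding A_def by (rule integral_nonneg_AE) simp
  have iA: "integrable lborel (\<lambda>t. exp (- (2 * \<nu>) * \<bar>t\<bar>))" using integrable_exp_abs[of "2 * \<nu>"] nu by simp
  have "\<bar>mixture_diff p \<nu> \<beta> h u\<bar> \<le> h powr (2 * \<nu>) * (C * A) / (\<Prod>i\<in>UNIV. 1 + \<bar>u $ i\<bar>)"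
    if b: "\<beta> > 0" and h: "h > 0" for \<beta> h u
  proof -
    let ?\<gamma> = "\<beta> * h\<^sup>2" and ?P = "\<Prod>i\<in>UNIV. 1 + \<bar>u $ i\<bar>"
    let ?d = "\<lambda>t. \<Sum>a\<le>p. diff_coeff p a * exp (- (norm (u + real a *\<^sub>R e1) / exp t)\<^sup>2)"
    have g: "?\<gamma> > 0" using b h by simp
    have P: "?P > 0" by (intro prod_pos) auto
    have "mixture_diff p \<nu> \<beta> h u = h powr (2 * \<nu>) * (\<Sum>a\<le>p. diff_coeff p a * mixture \<nu> ?\<gamma> (norm (u + real a *\<^sub>R e1)))"
      unfolding mixture_diff_def norm_scaleR using h by (simp add: mixture_scale sum_distrib_left mult_ac)
    also have "(\<Sum>a\<le>p. diff_coeff p a * mixture \<nu> ?\<gamma> (norm (u + real a *\<^sub>R e1)))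
      = (LINT t|lborel. (\<Sum>a\<le>p. diff_coeff p a * mixture_integrand \<nu> ?\<gamma> (norm (u + real a *\<^sub>R e1)) t))"
      unfolding mixture_def
      by (subst Bochner_Integration.integral_sum) (auto intro!: integrable_mult_right integrable_mixture nu g)
    also have "\<dots> = (LINT t|lborel. exp (2 * \<nu> * t) * exp (- ?\<gamma> * (exp t)\<^sup>2) * ?d t)"
      by (intro Bochner_Integration.integral_cong refl) (simp add: mixture_integrand_def sum_distrib_left mult_ac)
    finally have eq: "mixture_diff p \<nu> \<beta> h u = h powr (2 * \<nu>) * (LINT t|lborel. exp (2 * \<nu> * t) * exp (- ?\<gamma> * (exp t)\<^sup>2) * ?d t)" .
    have "norm (LINT t|lborel. exp (2 * \<nu> * t) * exp (- ?\<gamma> * (exp t)\<^sup>2) * ?d t) \<le> (LINT t|lborel. C / ?P * exp (- (2 * \<nu>) * \<bar>t\<bar>))"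
    proof (rule Bochner_Integration.integral_norm_bound_integral)
      show "integrable lborel (\<lambda>t. exp (2 * \<nu> * t) * exp (- ?\<gamma> * (exp t)\<^sup>2) * ?d t)"
      proof -
        have "integrable lborel (\<lambda>t. \<Sum>a\<le>p. diff_coeff p a * mixture_integrand \<nu> ?\<gamma> (norm (u + real a *\<^sub>R e1)) t)"
          by (intro Bochner_Integration.integrable_sum integrable_mult_right integrable_mixture nu g)
        then show ?thesis by (simp add: mixture_integrand_def sum_distrib_left mult_ac)
      qed
      show "integrable lborel (\<lambda>t. C / ?P * exp (- (2 * \<nu>) * \<bar>t\<bar>))" using iA by (rule integrable_mult_right)
      fix t
      have p4: "p \<ge> 4" using p nu by linarith
      have "?P * \<bar>?d t\<bar> \<le> C * (1 + exp t) ^ 4 / (1 + exp t) ^ p" using le[of "exp t" u] by simp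
      also have "(1 + exp t) ^ p = (1 + exp t) ^ 4 * (1 + exp t) ^ (p - 4)"
        using p4 by (simp flip: power_add)
      also have "C * (1 + exp t) ^ 4 / \<dots> = C / (1 + exp t) ^ (p - 4)"
        using exp_gt_zero[of t] by (simp add: field_simps add_pos_pos less_imp_neq[symmetric])
      finally have d: "\<bar>?d t\<bar> \<le> C / (1 + exp t) ^ (p - 4) / ?P" unfolding pos_le_divide_eq[OF P] by (subst mult.commute)
      have "norm (exp (2 * \<nu> * t) * exp (- ?\<gamma> * (exp t)\<^sup>2) * ?d t) = exp (2 * \<nu> * t) * exp (- ?\<gamma> * (exp t)\<^sup>2) * \<bar>?d t\<bar>"
        by (simp add: abs_mult)
      also have "\<dots> \<le> exp (2 * \<nu> * t) * 1 * (C / (1 + exp t) ^ (p - 4) / ?P)"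
        by (intro mult_mono d) (use g in auto)
      also have "\<dots> = (exp (2 * \<nu> * t) / (1 + exp t) ^ (p - 4)) * (C / ?P)" by simp
      also have "\<dots> \<le> exp (- (2 * \<nu>) * \<bar>t\<bar>) * (C / ?P)"
        by (intro mult_right_mono exp_weight_le nu) (use p p4 C P in \<open>auto simp: of_nat_diff\<close>)
      finally show "norm (exp (2 * \<nu> * t) * exp (- ?\<gamma> * (exp t)\<^sup>2) * ?d t) \<le> C / ?P * exp (- (2 * \<nu>) * \<bar>t\<bar>)"
        by (simp add: mult.commute)
    qed
    also have "\<dots> = C / ?P * A" by (simp add: A_def)
    finally have "h powr (2 * \<nu>) * \<bar>LINT t|lborel. exp (2 * \<nu> * t) * exp (- ?\<gamma> * (exp t)\<^sup>2) * ?d t\<bar> \<le> h powr (2 * \<nu>) * (C / ?P * A)"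
      by (intro mult_left_mono) auto
    then show ?thesis unfolding eq abs_mult by simp
  qed
  then show ?thesis using A C by (intro exI[of _ "C * A"]) auto
qed

text \<open>The substitution \<open>u = \<beta> exp (2 t)\<close> turns the integral into Euler's integral for the Gamma function.\<close>

lemma mixture_0_gamma:
  assumes nu: "\<nu> > 0" and b: "\<beta> > 0"
  shows "mixture \<nu> \<beta> 0 = Gamma \<nu> / (2 * \<beta> powr \<nu>)"
proof -
  define g where "g t = \<beta> * exp (2 * t)" for t :: real
  define f where "f u = u powr (\<nu> - 1) / exp u" for u :: real
  have fg: "f (g t) * (2 * g t) = 2 * \<beta> powr \<nu> * mixture_integrand \<nu> \<beta> 0 t" for t
  proof -
    have g0: "g t > 0" using b by (simp add: g_def)
    have "f (g t) * (2 * g t) = 2 * g t powr \<nu> * exp (- g t)"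
      using g0 by (simp add: f_def powr_diff exp_minus divide_simps)
    also have "g t powr \<nu> = \<beta> powr \<nu> * exp (2 * \<nu> * t)"
      unfolding g_def using b by (simp add: powr_def ln_mult exp_add[symmetric] algebra_simps)
    also have "exp (- g t) = exp (- \<beta> * (exp t)\<^sup>2)" unfolding g_def by (simp add: exp_double)
    finally show ?thesis by (simp add: mixture_integrand_def)
  qed
  have int: "set_integrable lborel (einterval (-\<infinity>) \<infinity>) (\<lambda>t. f (g t) * (2 * g t))"
    unfolding fg set_integrable_def using integrable_mixture[OF nu b, of 0] by (simp add: einterval_def)
  have lim0: "((ereal \<circ> g \<circ> real_of_ereal) \<longlongrightarrow> 0) (at_right (-\<infinity>))"
  proof -
    have "(g \<longlongrightarrow> 0) at_bot" unfolding g_def by real_asymp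
    then show ?thesis unfolding ereal_tendsto_simps1 zero_ereal_def ereal_tendsto_simps2 .
  qed
  have lim1: "((ereal \<circ> g \<circ> real_of_ereal) \<longlongrightarrow> \<infinity>) (at_left \<infinity>)"
  proof -
    have "filterlim g at_top at_top" unfolding g_def using b by real_asymp
    then show ?thesis unfolding ereal_tendsto_simps1 ereal_tendsto_simps2 .
  qed
  note sub = interval_integral_substitution_nonneg[of "-\<infinity>" \<infinity> g "\<lambda>t. 2 * g t" f, OF _ _ _ _ _ _ lim0 lim1 int]
  have g': "DERIV g t :> 2 * g t" for t unfolding g_def by (auto intro!: derivative_eq_intros)
  have cf: "isCont f (g t)" for t
    unfolding f_def using b by (intro continuous_intros) (auto simp: g_def)
  have cg: "isCont (\<lambda>t. 2 * g t) t" for t unfolding g_def by (intro continuous_intros)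
  have nn: "0 \<le> f (g t)" "0 \<le> 2 * g t" for t using b by (auto simp: f_def g_def)
  have S: "set_integrable lborel {0<..} f" "(LBINT u=0..\<infinity>. f u) = (LBINT t=-\<infinity>..\<infinity>. f (g t) * (2 * g t))"
  proof -
    have "einterval 0 \<infinity> = {0::real<..}" by (auto simp: einterval_def)
    moreover have "set_integrable lborel (einterval 0 \<infinity>) f"
      by (rule sub(1)) (rule g' cf cg nn | simp)+
    ultimately show "set_integrable lborel {0<..} f" by simp
    show "(LBINT u=0..\<infinity>. f u) = (LBINT t=-\<infinity>..\<infinity>. f (g t) * (2 * g t))"
      by (rule sub(2)) (rule g' cf cg nn | simp)+
  qed
  have "(LBINT t=-\<infinity>..\<infinity>. f (g t) * (2 * g t)) = 2 * \<beta> powr \<nu> * mixture \<nu> \<beta> 0"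
    unfolding fg interval_integral_to_infinity_eq
    by (simp add: interval_lebesgue_integral_def einterval_def set_lebesgue_integral_def mixture_def)
  moreover have "(LBINT u=0..\<infinity>. f u) = (LINT u:{0<..}|lborel. f u)"
    by (simp add: interval_lebesgue_integral_0_infty)
  moreover have "(LINT u:{0<..}|lborel. f u) = Gamma \<nu>"
  proof -
    have "(f has_integral (LINT u:{0<..}|lborel. f u)) {0<..}"
      using set_borel_integral_eq_integral[OF S(1)] by (simp add: has_integral_integral)
    moreover have "(f has_integral Gamma \<nu>) {0<..}"
    proof -
      have "(f has_integral Gamma \<nu>) {0..}" unfolding f_def[abs_def] by (rule Gamma_integral_real[OF nu])
      moreover have "{0..} - {0<..} = {0::real}" by auto
      ultimately show ?thesis
        using has_integral_interior[of "{0::real..}" f "Gamma \<nu>"] \<open>{0..} - {0<..} = {0::real}\<close>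
        by (simp add: frontier_def interior_real_atLeast)
    qed
    ultimately show ?thesis by (rule has_integral_unique)
  qed
  ultimately have "2 * \<beta> powr \<nu> * mixture \<nu> \<beta> 0 = Gamma \<nu>" using S(2) by simp
  then show ?thesis using b by (simp add: field_simps)
qed

text \<open>The Bessel integral is half of the integral of \<open>exp (\<nu> v - \<alpha> r cosh v)\<close> over the line. Translating
  \<open>v\<close> by \<open>ln (\<alpha> / (2 r))\<close> splits \<open>\<alpha> r cosh v\<close> into a part independent of \<open>r\<close> and a part independent
  of \<open>\<alpha>\<close>.\<close>

lemma bessel_K_mixture:
  assumes nu: "\<nu> > 0" and a: "\<alpha> > 0" and r: "r > 0"
  shows "bessel_K \<nu> (\<alpha> * r) = (\<alpha> / (2 * r)) powr \<nu> * mixture \<nu> (\<alpha>\<^sup>2 / 4) r"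
proof -
  \<comment> \<open>balances the two exponentials in \<open>cosh\<close>; the factor 2 in \<open>2 * t\<close> below matches the square in \<open>exp (- (r / exp t)\<^sup>2)\<close>\<close>
  define \<eta> where "\<eta> = \<alpha> / (2 * r)"
  have eta: "\<eta> > 0" using a r by (simp add: \<eta>_def)
  define f where "f v = exp (\<nu> * v) * exp (- (\<alpha> * r) * cosh v)" for v
  have aff: "f (ln \<eta> + 2 * t) = \<eta> powr \<nu> * mixture_integrand \<nu> (\<alpha>\<^sup>2 / 4) r t" for t
  proof -
    have w: "exp (\<nu> * (ln \<eta> + 2 * t)) = \<eta> powr \<nu> * exp (2 * \<nu> * t)"
      using eta by (simp add: powr_def exp_add[symmetric] algebra_simps)
    have E: "exp (ln \<eta> + 2 * t) = \<eta> * (exp t)\<^sup>2"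
      using eta by (simp add: exp_add exp_double)
    have "cosh (ln \<eta> + 2 * t) = (\<eta> * (exp t)\<^sup>2 + 1 / (\<eta> * (exp t)\<^sup>2)) / 2"
      by (simp only: cosh_field_def exp_minus E inverse_eq_divide)
    then have "(\<alpha> * r) * cosh (ln \<eta> + 2 * t) = (\<alpha> * r) * (\<eta> * (exp t)\<^sup>2) / 2 + (\<alpha> * r) / (\<eta> * (exp t)\<^sup>2) / 2"
      by (simp only: distrib_left add_divide_distrib times_divide_eq_right mult_1_right)
    also have "(\<alpha> * r) * (\<eta> * (exp t)\<^sup>2) / 2 = \<alpha>\<^sup>2 / 4 * (exp t)\<^sup>2"
      using r by (simp add: \<eta>_def power2_eq_square)
    also have "(\<alpha> * r) / (\<eta> * (exp t)\<^sup>2) / 2 = (r / exp t)\<^sup>2"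
      using a by (simp add: \<eta>_def power2_eq_square)
    finally have c: "- (\<alpha> * r) * cosh (ln \<eta> + 2 * t) = - (\<alpha>\<^sup>2 / 4) * (exp t)\<^sup>2 + - (r / exp t)\<^sup>2" by simp
    show ?thesis unfolding f_def w c exp_add mixture_integrand_def by simp
  qed
  have a4: "\<alpha>\<^sup>2 / 4 > 0" using a by simp
  have "integrable lborel (\<lambda>t. f (ln \<eta> + 2 * t))"
    unfolding aff by (intro integrable_mult_right integrable_mixture nu a4)
  then have intf: "integrable lborel f" by (subst (asm) lborel_integrable_real_affine_iff) auto
  have "(LINT v|lborel. f v) = 2 * (LINT t|lborel. f (ln \<eta> + 2 * t))"
    by (subst lborel_integral_real_affine[where c=2 and t="ln \<eta>"]) auto
  also have "\<dots> = 2 * (\<eta> powr \<nu> * mixture \<nu> (\<alpha>\<^sup>2 / 4) r)" unfolding aff mixture_def by simp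
  finally have I: "(LINT v|lborel. f v) = 2 * (\<eta> powr \<nu> * mixture \<nu> (\<alpha>\<^sup>2 / 4) r)" .
  define E where "E v = exp (- (\<alpha> * r) * cosh v) * cosh (\<nu> * v)" for v
  have E: "E v = (f v + f (- v)) / 2" for v
    unfolding E_def f_def by (simp add: cosh_def field_simps)
  have intf': "integrable lborel (\<lambda>v. f (- v))"
    using lborel_integrable_real_affine[OF intf, of "-1" 0] by simp
  have intE: "integrable lborel E" unfolding E[abs_def] using intf intf' by simp
  have "(LINT v|lborel. E v) = ((LINT v|lborel. f v) + (LINT v|lborel. f (- v))) / 2"
    unfolding E using intf intf' by simp
  also have "(LINT v|lborel. f (- v)) = (LINT v|lborel. f v)"
    by (subst (2) lborel_integral_real_affine[where c="-1" and t=0]) auto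
  finally have 1: "(LINT v|lborel. E v) = (LINT v|lborel. f v)" by simp
  have "integrable lborel (\<lambda>v. indicator {0..} v *\<^sub>R E v)"
    by (rule integrable_mult_indicator[OF _ intE]) auto
  then have "has_bochner_integral lborel (\<lambda>v. indicator {0..} v *\<^sub>R E v) (LINT v|lborel. indicator {0..} v *\<^sub>R E v)"
    by (simp add: has_bochner_integral_iff)
  from has_bochner_integral_even_function[OF this]
  have "(LINT v|lborel. E v) = 2 * (LINT v|lborel. indicator {0..} v *\<^sub>R E v)"
    by (auto simp: E_def dest: has_bochner_integral_integral_eq)
  then have "2 * bessel_K \<nu> (\<alpha> * r) = (LINT v|lborel. E v)"
    unfolding bessel_K_def E_def set_lebesgue_integral_def by simp
  then show ?thesis using 1 I by (simp add: \<eta>_def)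
qed

text \<open>The prefactor depends on \<open>\<sigma>\<close> and \<open>\<alpha>\<close> only through \<open>\<sigma>\<^sup>2 \<alpha> powr (2 \<nu>)\<close>.\<close>

lemma matern_cov_mixture:
  assumes nu: "\<nu> > 0" and a: "\<alpha> > 0"
  shows "matern_cov \<sigma> \<alpha> \<nu> h =
    (2 * 4 powr (- \<nu>) * (\<sigma>\<^sup>2 * \<alpha> powr (2 * \<nu>)) / Gamma \<nu>) * mixture \<nu> (\<alpha>\<^sup>2 / 4) (norm h)"
proof -
  have G: "Gamma \<nu> > 0" using nu by (rule Gamma_real_pos)
  have a2: "\<alpha> powr (2 * \<nu>) = \<alpha> powr \<nu> * \<alpha> powr \<nu>" by (simp flip: powr_add)
  have four: "4 powr (- \<nu>) = 1 / (2 powr \<nu> * 2 powr \<nu>)"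
    by (simp add: powr_minus_divide flip: powr_mult)
  show ?thesis
  proof (cases "h = 0")
    case True
    have "(\<alpha>\<^sup>2 / 4) powr \<nu> = \<alpha> powr (2 * \<nu>) / (2 powr \<nu> * 2 powr \<nu>)"
      using a by (simp add: powr_divide power2_eq_square powr_mult a2 flip: powr_mult)
    then show ?thesis using True a less_imp_neq[OF G, symmetric]
      by (simp add: matern_cov_def mixture_0_gamma nu four)
  next
    case False
    then have r: "norm h > 0" by simp
    show ?thesis
      using False r a G unfolding matern_cov_def bessel_K_mixture[OF nu a r] four a2
      by (simp add: powr_mult powr_divide powr_diff mult_ac)
  qed
qed

section \<open>The gap between increment variances\<close>

text \<open>The variance of an increment of order \<open>p\<close> and step one for the Gaussian covariance \<open>exp (- u r\<^sup>2)\<close>.\<close>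

definition stencil_form :: "nat \<Rightarrow> real \<Rightarrow> real" where
  "stencil_form p u = (\<Sum>a\<le>p. \<Sum>b\<le>p. diff_coeff p a * diff_coeff p b * exp (- ((real b - real a)\<^sup>2 * u)))"

text \<open>Expanding the mixed factor \<open>exp (2 u a b)\<close> of \<open>exp (- (b - a)\<^sup>2 u)\<close> in its power series exhibits the
  form as a series of squares.\<close>

lemma stencil_form_nonneg:
  assumes u: "u \<ge> 0" shows "0 \<le> stencil_form p u"
proof -
  let ?v = "\<lambda>n a. diff_coeff p a * exp (- (real a)\<^sup>2 * u) * real a ^ n"
  have "(\<lambda>n. (2 * u * real a * real b) ^ n /\<^sub>R fact n) sums exp (2 * u * real a * real b)" for a b
    by (rule exp_converges)
  then have series: "(\<lambda>n. \<Sum>a\<le>p. \<Sum>b\<le>p. (diff_coeff p a * exp (- (real a)\<^sup>2 * u)) * (diff_coeff p b * exp (- (real b)\<^sup>2 * u)) *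
      ((2 * u * real a * real b) ^ n /\<^sub>R fact n))
    sums (\<Sum>a\<le>p. \<Sum>b\<le>p. (diff_coeff p a * exp (- (real a)\<^sup>2 * u)) * (diff_coeff p b * exp (- (real b)\<^sup>2 * u)) * exp (2 * u * real a * real b))"
    by (intro sums_sum sums_mult)
  have square: "(\<Sum>a\<le>p. \<Sum>b\<le>p. (diff_coeff p a * exp (- (real a)\<^sup>2 * u)) * (diff_coeff p b * exp (- (real b)\<^sup>2 * u)) *
      ((2 * u * real a * real b) ^ n /\<^sub>R fact n)) = (2 * u) ^ n / fact n * (\<Sum>a\<le>p. ?v n a)\<^sup>2" for n
    unfolding power2_eq_square[of "sum _ _"] sum_product unfolding sum_distrib_left
    by (intro sum.cong refl) (simp add: power_mult_distrib divide_inverse mult_ac)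
  have mixture_kernel: "(diff_coeff p a * exp (- (real a)\<^sup>2 * u)) * (diff_coeff p b * exp (- (real b)\<^sup>2 * u)) * exp (2 * u * real a * real b)
     = diff_coeff p a * diff_coeff p b * exp (- ((real b - real a)\<^sup>2 * u))" for a b
  proof -
    have "exp (- (real a)\<^sup>2 * u) * exp (- (real b)\<^sup>2 * u) * exp (2 * u * real a * real b) = exp (- ((real b - real a)\<^sup>2 * u))"
      unfolding exp_add[symmetric] by (simp add: power2_eq_square algebra_simps)
    then show ?thesis by (simp only: mult_ac)
  qed
  have "(\<lambda>n. (2 * u) ^ n / fact n * (\<Sum>a\<le>p. ?v n a)\<^sup>2) sums stencil_form p u"
    using series unfolding square mixture_kernel stencil_form_def .
  moreover have "0 \<le> (2 * u) ^ n / fact n * (\<Sum>a\<le>p. ?v n a)\<^sup>2" for n using u by simp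
  ultimately show ?thesis by (rule sums_le[OF _ sums_zero, rotated])
qed

text \<open>As \<open>u\<close> grows the off-diagonal terms vanish and the sum of the squared coefficients remains, which is
  at least one.\<close>

lemma stencil_form_lower: "\<exists>U\<ge>1. \<forall>u\<ge>U. stencil_form p u \<ge> 1 / 2"
proof -
  have "((\<lambda>u. diff_coeff p a * diff_coeff p b * exp (- ((real b - real a)\<^sup>2 * u))) \<longlongrightarrow> (if b = a then (diff_coeff p a)\<^sup>2 else 0)) at_top" for a b
  proof (cases "a = b")
    case True
    then show ?thesis by (simp add: power2_eq_square)
  next
    case False
    then have k: "(real b - real a)\<^sup>2 > 0" by simp
    have "((\<lambda>u. exp (- (k * u))) \<longlongrightarrow> 0) at_top" if "k > 0" for k :: real using that by real_asymp
    from tendsto_mult_left[OF this[OF k], of "diff_coeff p a * diff_coeff p b"] show ?thesis using False by simp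
  qed
  then have "(stencil_form p \<longlongrightarrow> (\<Sum>a\<le>p. \<Sum>b\<le>p. if b = a then (diff_coeff p a)\<^sup>2 else 0)) at_top"
    unfolding stencil_form_def by (intro tendsto_sum)
  moreover have "(\<Sum>a\<le>p. \<Sum>b\<le>p. if b = a then (diff_coeff p a)\<^sup>2 else 0) > 1 / 2"
  proof -
    have "(\<Sum>a\<in>{0}. (diff_coeff p a)\<^sup>2) \<le> (\<Sum>a\<le>p. (diff_coeff p a)\<^sup>2)" by (rule sum_mono2) auto
    then show ?thesis by (simp add: diff_coeff_def)
  qed
  ultimately have "\<forall>\<^sub>F u in at_top. stencil_form p u > 1 / 2" by (rule order_tendstoD)
  then obtain U where "\<And>u. u \<ge> U \<Longrightarrow> stencil_form p u > 1 / 2" by (auto simp: eventually_at_top_linorder)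
  then show ?thesis by (intro exI[of _ "max 1 U"]) (auto intro: less_imp_le)
qed

abbreviation mixture_kernel :: "real \<Rightarrow> real \<Rightarrow> real^4 \<Rightarrow> real^4 \<Rightarrow> real" where
  "mixture_kernel \<nu> \<beta> s t \<equiv> mixture \<nu> \<beta> (norm (t - s))"

text \<open>The step of the increment in direction \<open>e1\<close> equals the spacing \<open>h\<close> of the grid of starting points, so
  that a rescaling of lags by \<open>h\<close> normalises both.\<close>

definition stencil :: "real^4 \<Rightarrow> real \<Rightarrow> (4 \<Rightarrow> nat) \<Rightarrow> nat \<Rightarrow> real^4" where
  "stencil x h k a = x + h *\<^sub>R ((\<chi> i. real (k i)) + real a *\<^sub>R e1)"

lemma comb_cov_stencil:
  assumes nu: "\<nu> > 0" and b: "\<beta> > 0" and h: "h > 0"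
  shows "comb_cov {..p} (diff_coeff p) (mixture_kernel \<nu> \<beta>) (stencil x h k) (stencil x h k) =
    h powr (2 * \<nu>) * (LINT t|lborel. exp (2 * \<nu> * t) * exp (- (\<beta> * h\<^sup>2) * (exp t)\<^sup>2) * stencil_form p (1 / (exp t)\<^sup>2))"
    and "integrable lborel (\<lambda>t. exp (2 * \<nu> * t) * exp (- (\<beta> * h\<^sup>2) * (exp t)\<^sup>2) * stencil_form p (1 / (exp t)\<^sup>2))"
proof -
  have g: "\<beta> * h\<^sup>2 > 0" using b h by simp
  have d: "stencil x h k j - stencil x h k i = (h * (real j - real i)) *\<^sub>R e1" for i j
    by (simp add: stencil_def algebra_simps)
  have n: "norm (stencil x h k j - stencil x h k i) = h * \<bar>real j - real i\<bar>" for i j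
    unfolding d using h by (simp add: abs_mult norm_axis_1)
  have eq: "exp (2 * \<nu> * t) * exp (- (\<beta> * h\<^sup>2) * (exp t)\<^sup>2) * stencil_form p (1 / (exp t)\<^sup>2) =
     (\<Sum>i\<le>p. \<Sum>j\<le>p. diff_coeff p i * diff_coeff p j * mixture_integrand \<nu> (\<beta> * h\<^sup>2) \<bar>real j - real i\<bar> t)" for t
    unfolding stencil_form_def mixture_integrand_def sum_distrib_left
    by (intro sum.cong refl) (simp add: power_divide mult_ac)
  have i: "integrable lborel (\<lambda>t. diff_coeff p i * diff_coeff p j * mixture_integrand \<nu> (\<beta> * h\<^sup>2) \<bar>real j - real i\<bar> t)" for i j
    by (intro integrable_mult_right integrable_mixture nu g)
  show "integrable lborel (\<lambda>t. exp (2 * \<nu> * t) * exp (- (\<beta> * h\<^sup>2) * (exp t)\<^sup>2) * stencil_form p (1 / (exp t)\<^sup>2))"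
    unfolding eq by (intro Bochner_Integration.integrable_sum i)
  have "(LINT t|lborel. exp (2 * \<nu> * t) * exp (- (\<beta> * h\<^sup>2) * (exp t)\<^sup>2) * stencil_form p (1 / (exp t)\<^sup>2))
    = (\<Sum>i\<le>p. \<Sum>j\<le>p. diff_coeff p i * diff_coeff p j * mixture \<nu> (\<beta> * h\<^sup>2) \<bar>real j - real i\<bar>)"
    unfolding eq mixture_def using i
    by (simp add: Bochner_Integration.integral_sum Bochner_Integration.integrable_sum integrable_mixture[OF nu g])
  then show "comb_cov {..p} (diff_coeff p) (mixture_kernel \<nu> \<beta>) (stencil x h k) (stencil x h k) =
    h powr (2 * \<nu>) * (LINT t|lborel. exp (2 * \<nu> * t) * exp (- (\<beta> * h\<^sup>2) * (exp t)\<^sup>2) * stencil_form p (1 / (exp t)\<^sup>2))"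
    unfolding comb_cov_def n mixture_scale[OF h] by (simp add: sum_distrib_left mult_ac)
qed

lemma exp_diff_lower:
  fixes \<beta>1 \<beta>2 y :: real
  assumes "0 < \<beta>1" "\<beta>1 < \<beta>2" "0 \<le> y" "y \<le> 1"
  shows "(\<beta>2 - \<beta>1) * y * exp (- \<beta>2) \<le> exp (- \<beta>1 * y) - exp (- \<beta>2 * y)"
proof -
  have "(\<beta>2 - \<beta>1) * y * exp (- \<beta>2) \<le> (\<beta>2 - \<beta>1) * y * exp (- \<beta>2 * y)"
    using assms by (intro mult_left_mono) auto
  also have "\<dots> \<le> (exp ((\<beta>2 - \<beta>1) * y) - 1) * exp (- \<beta>2 * y)"
    using exp_ge_add_one_self[of "(\<beta>2 - \<beta>1) * y"] by (intro mult_right_mono; linarith?) simp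
  also have "\<dots> = exp (- \<beta>1 * y) - exp (- \<beta>2 * y)"
    by (simp add: left_diff_distrib flip: exp_add)
  finally show ?thesis .
qed

text \<open>By \<open>stencil_form_nonneg\<close> the integrand of the difference is nonnegative, so the integral may be restricted
  to an interval of unit length in \<open>t\<close> where \<open>stencil_form\<close> is at least \<open>1 / 2\<close>. There the factors
  \<open>exp (- \<beta> h\<^sup>2 exp (2 t))\<close> for the two values of \<open>\<beta>\<close> differ by order \<open>h\<^sup>2\<close>.\<close>

lemma comb_cov_stencil_gap:
  assumes nu: "\<nu> > 0" and b: "0 < \<beta>1" "\<beta>1 < \<beta>2"
  shows "\<exists>c>0. \<forall>x h k. 0 < h \<longrightarrow> h \<le> 1 \<longrightarrow>
    c * (h powr (2 * \<nu>) * h\<^sup>2) \<le> comb_cov {..p} (diff_coeff p) (mixture_kernel \<nu> \<beta>1) (stencil x h k) (stencil x h k)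
       - comb_cov {..p} (diff_coeff p) (mixture_kernel \<nu> \<beta>2) (stencil x h k) (stencil x h k)"
proof -
  obtain U where U: "U \<ge> 1" "\<And>u. u \<ge> U \<Longrightarrow> stencil_form p u \<ge> 1 / 2" using stencil_form_lower by blast
  \<comment> \<open>for \<open>t \<le> t0\<close> the argument \<open>1 / (exp t)\<^sup>2\<close> is at least \<open>U\<close>; \<open>t0 \<le> 0\<close> keeps \<open>h * exp t\<close> at most one\<close>
  define t0 where "t0 = - ln U / 2"
  have t0: "t0 \<le> 0" using U by (simp add: t0_def)
  have q: "stencil_form p (1 / (exp t)\<^sup>2) \<ge> 1 / 2" if "t \<le> t0" for t
  proof (rule U(2))
    have "U = exp (- (2 * t0))" using U(1) by (simp add: t0_def)
    also have "\<dots> \<le> exp (- (2 * t))" using that by simp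
    also have "\<dots> = 1 / (exp t)\<^sup>2" by (simp add: exp_minus exp_double inverse_eq_divide)
    finally show "U \<le> 1 / (exp t)\<^sup>2" .
  qed
  define c where "c = exp (2 * \<nu> * (t0 - 1)) * ((\<beta>2 - \<beta>1) * (exp (t0 - 1))\<^sup>2 * exp (- \<beta>2)) * (1 / 2)"
  have c: "c > 0" using b by (simp add: c_def)
  have "c * (h powr (2 * \<nu>) * h\<^sup>2) \<le> comb_cov {..p} (diff_coeff p) (mixture_kernel \<nu> \<beta>1) (stencil x h k) (stencil x h k)
       - comb_cov {..p} (diff_coeff p) (mixture_kernel \<nu> \<beta>2) (stencil x h k) (stencil x h k)"
    if h: "0 < h" "h \<le> 1" for x h k
  proof -
    let ?f = "\<lambda>\<beta> t. exp (2 * \<nu> * t) * exp (- (\<beta> * h\<^sup>2) * (exp t)\<^sup>2) * stencil_form p (1 / (exp t)\<^sup>2)"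
    have b2: "0 < \<beta>2" using b by simp
    note i1 = comb_cov_stencil(2)[OF nu b(1) h(1), of p] and i2 = comb_cov_stencil(2)[OF nu b2 h(1), of p]
    have "c * h\<^sup>2 = (LINT t|lborel. indicator {t0 - 1..t0} t * (c * h\<^sup>2))" by simp
    also have "\<dots> \<le> (LINT t|lborel. ?f \<beta>1 t - ?f \<beta>2 t)"
    proof (rule integral_mono)
      show "integrable lborel (\<lambda>t. indicator {t0 - 1..t0} t * (c * h\<^sup>2))" by simp
      show "integrable lborel (\<lambda>t. ?f \<beta>1 t - ?f \<beta>2 t)" using i1 i2 by simp
      fix t
      let ?y = "h\<^sup>2 * (exp t)\<^sup>2" and ?q = "stencil_form p (1 / (exp t)\<^sup>2)"
      have f: "?f \<beta>1 t - ?f \<beta>2 t = exp (2 * \<nu> * t) * (exp (- \<beta>1 * ?y) - exp (- \<beta>2 * ?y)) * ?q"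
        by (simp add: algebra_simps)
      have q0: "?q \<ge> 0" by (intro stencil_form_nonneg) simp
      show "indicator {t0 - 1..t0} t * (c * h\<^sup>2) \<le> ?f \<beta>1 t - ?f \<beta>2 t"
      proof (cases "t \<in> {t0 - 1..t0}")
        case False
        have "0 \<le> ?y" by simp
        then have "\<beta>1 * ?y \<le> \<beta>2 * ?y" using b by (intro mult_right_mono) auto
        then show ?thesis unfolding f using q0 False by (simp add: mult.assoc)
      next
        case True
        have e1: "(exp (t0 - 1))\<^sup>2 \<le> (exp t)\<^sup>2" using True by (intro power_mono) auto
        have "(exp t)\<^sup>2 \<le> 1" using True t0 by (intro power_le_one) auto
        moreover have "h\<^sup>2 \<le> 1" using h by (intro power_le_one) auto
        ultimately have y: "?y \<le> 1" "0 \<le> ?y" by (auto intro: mult_le_one)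
        have "(\<beta>2 - \<beta>1) * (exp (t0 - 1))\<^sup>2 * exp (- \<beta>2) * h\<^sup>2 = (\<beta>2 - \<beta>1) * (h\<^sup>2 * (exp (t0 - 1))\<^sup>2) * exp (- \<beta>2)"
          by simp
        also have "\<dots> \<le> (\<beta>2 - \<beta>1) * ?y * exp (- \<beta>2)"
          using b e1 by (intro mult_right_mono mult_left_mono) auto
        also have "\<dots> \<le> exp (- \<beta>1 * ?y) - exp (- \<beta>2 * ?y)" by (rule exp_diff_lower[OF b y(2,1)])
        finally have d: "(\<beta>2 - \<beta>1) * (exp (t0 - 1))\<^sup>2 * exp (- \<beta>2) * h\<^sup>2 \<le> exp (- \<beta>1 * ?y) - exp (- \<beta>2 * ?y)" .
        have d0: "0 \<le> (\<beta>2 - \<beta>1) * (exp (t0 - 1))\<^sup>2 * exp (- \<beta>2) * h\<^sup>2" using b by simp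
        have "c * h\<^sup>2 = exp (2 * \<nu> * (t0 - 1)) * ((\<beta>2 - \<beta>1) * (exp (t0 - 1))\<^sup>2 * exp (- \<beta>2) * h\<^sup>2) * (1 / 2)"
          unfolding c_def by simp
        also have "\<dots> \<le> exp (2 * \<nu> * t) * (exp (- \<beta>1 * ?y) - exp (- \<beta>2 * ?y)) * ?q"
          by (intro mult_mono d q mult_nonneg_nonneg order_trans[OF d0 d]) (use True nu b in auto)
        finally show ?thesis unfolding f using True by simp
      qed
    qed
    also have "\<dots> = (LINT t|lborel. ?f \<beta>1 t) - (LINT t|lborel. ?f \<beta>2 t)" using i1 i2 by simp
    finally have "h powr (2 * \<nu>) * (c * h\<^sup>2) \<le> h powr (2 * \<nu>) * ((LINT t|lborel. ?f \<beta>1 t) - (LINT t|lborel. ?f \<beta>2 t))"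
      by (rule mult_left_mono) simp
    then show ?thesis
      unfolding comb_cov_stencil(1)[OF nu b(1) h(1)] comb_cov_stencil(1)[OF nu b2 h(1)]
      by (simp add: algebra_simps)
  qed
  then show ?thesis using c by blast
qed

section \<open>Correlations between increments\<close>

text \<open>The summand at \<open>x\<close> is at most \<open>2 (h (x + 1) - h x)\<close> for the bounded function \<open>h x = x / (1 + \<bar>x\<bar>)\<close>, so
  the sum telescopes, uniformly in \<open>\<omega>\<close>.\<close>

lemma lattice_sum_le:
  fixes \<omega> :: real shows "(\<Sum>k<n. 1 / (1 + \<bar>\<omega> + real k\<bar>)\<^sup>2) \<le> 4"
proof -
  define h :: "real \<Rightarrow> real" where "h x = x / (1 + \<bar>x\<bar>)" for x
  define g :: "real \<Rightarrow> real" where "g x = 1 / (1 + \<bar>x\<bar>)\<^sup>2" for x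
  have step: "g x \<le> 2 * (h (x + 1) - h x)" for x :: real
  proof -
    consider "x \<ge> 0" | "x \<le> - 1" | "- 1 < x" "x < 0" by linarith
    then show ?thesis
    proof cases
      case 1
      have d: "h (x + 1) - h x = 1 / ((1 + x) * (2 + x))"
        using 1 by (simp add: h_def divide_simps) (simp add: algebra_simps)
      have le: "1 / (2 * (1 + x)\<^sup>2) \<le> 1 / ((1 + x) * (2 + x))"
      proof (rule frac_le)
        show "(1 + x) * (2 + x) \<le> 2 * (1 + x)\<^sup>2" using 1 by (simp add: power2_eq_square algebra_simps)
      qed (use 1 in auto)
      have s: "g x = 2 * (1 / (2 * (1 + x)\<^sup>2))" using 1 by (simp add: g_def)
      show ?thesis unfolding d s by (rule mult_left_mono[OF le]) simp
    next
      case 2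
      define y where "y = - x - 1"
      have x: "x = - y - 1" and y: "y \<ge> 0" using 2 by (auto simp: y_def)
      have d: "h (x + 1) - h x = 1 / ((1 + y) * (2 + y))"
        unfolding x using y by (simp add: h_def divide_simps) (simp add: algebra_simps)
      have "g x = 1 / (2 + y)\<^sup>2" using x y by (simp add: g_def)
      also have "\<dots> \<le> 1 / ((1 + y) * (2 + y))"
      proof (rule frac_le)
        show "(1 + y) * (2 + y) \<le> (2 + y)\<^sup>2" using y by (simp add: power2_eq_square algebra_simps)
      qed (use y in auto)
      finally have "g x \<le> h (x + 1) - h x" unfolding d .
      moreover have "0 \<le> g x" by (simp add: g_def)
      ultimately show ?thesis unfolding right_diff_distrib by linarith
    next
      case 3
      have a: "(x + 1) / 2 \<le> h (x + 1)" unfolding h_def using 3 by (intro divide_left_mono) auto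
      have b: "- x / 2 \<le> - h x"
      proof -
        have "- x / 2 \<le> - x / (1 + \<bar>x\<bar>)" using 3 by (intro divide_left_mono) auto
        then show ?thesis by (simp add: h_def)
      qed
      have "(1 + \<bar>x\<bar>)\<^sup>2 \<ge> 1" by (intro one_le_power) auto
      then have "g x \<le> 1" by (simp add: g_def divide_simps)
      moreover have "(x + 1) / 2 + - x / 2 = 1 / 2" by (simp add: field_simps)
      ultimately show ?thesis unfolding right_diff_distrib using a b by linarith
    qed
  qed
  have "(\<Sum>k<n. g (\<omega> + real k)) \<le> (\<Sum>k<n. 2 * (h (\<omega> + real (Suc k)) - h (\<omega> + real k)))"
    using step[of "\<omega> + real _"] by (intro sum_mono) (simp add: add_ac)
  also have "\<dots> = 2 * (h (\<omega> + real n) - h (\<omega> + real 0))"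
    unfolding sum_distrib_left[symmetric] by (subst sum_lessThan_telescope) simp
  also have "\<dots> \<le> 4"
  proof -
    have "\<bar>h x\<bar> \<le> 1" for x :: real by (simp add: h_def abs_divide)
    from this[of "\<omega> + real n"] this[of "\<omega> + real 0"] show ?thesis unfolding right_diff_distrib by linarith
  qed
  finally show ?thesis by (simp add: g_def)
qed

definition grid :: "nat \<Rightarrow> (4 \<Rightarrow> nat) set" where "grid n = (\<Pi>\<^sub>E i\<in>UNIV. {..<n})"

lemma finite_grid [simp]: "finite (grid n)"
  unfolding grid_def by (rule finite_PiE) auto

lemma card_grid: "card (grid n) = n ^ 4"
  unfolding grid_def by (subst card_PiE) auto

lemma grid_sum_le:
  fixes v :: "real^4"
  shows "(\<Sum>k\<in>grid n. (1 / (\<Prod>i\<in>UNIV. 1 + \<bar>((\<chi> i. real (k i)) + v) $ i\<bar>))\<^sup>2) \<le> 256"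
proof -
  have "(\<Sum>k\<in>grid n. (1 / (\<Prod>i\<in>UNIV. 1 + \<bar>((\<chi> i. real (k i)) + v) $ i\<bar>))\<^sup>2)
    = (\<Sum>k\<in>grid n. \<Prod>i\<in>UNIV. 1 / (1 + \<bar>v $ i + real (k i)\<bar>)\<^sup>2)"
    by (intro sum.cong refl) (simp add: prod_dividef prod_power_distrib power_divide add.commute)
  also have "\<dots> = (\<Prod>i\<in>UNIV. \<Sum>k<n. 1 / (1 + \<bar>v $ i + real k\<bar>)\<^sup>2)"
    unfolding grid_def by (subst prod_sum_PiE) auto
  also have "\<dots> \<le> (\<Prod>i\<in>(UNIV::4 set). 4)"
    by (intro prod_mono conjI lattice_sum_le sum_nonneg) auto
  finally show ?thesis by simp
qed

text \<open>The combination at \<open>\<sigma>\<close> is arbitrary: the covariance is a combination of \<open>p + 1\<close> values of \<open>mixture_diff\<close>,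
  which are square summable over the grid whatever the offset. This is why one constant serves all
  pairs of scales.\<close>

lemma comb_cov_sum_bound:
  assumes nu: "\<nu> > 0" and p: "real p \<ge> 4 + 4 * \<nu>"
  shows "\<exists>B\<ge>0. \<forall>\<beta>>0. \<forall>h>0. \<forall>x \<sigma> n.
    (\<Sum>k\<in>grid n. (comb_cov {..p} (diff_coeff p) (mixture_kernel \<nu> \<beta>) \<sigma> (stencil x h k))\<^sup>2) \<le> B * (h powr (2 * \<nu>))\<^sup>2"
proof -
  obtain C where C: "C \<ge> 0" and dec: "\<And>\<beta> h u. \<beta> > 0 \<Longrightarrow> h > 0 \<Longrightarrow>
      \<bar>mixture_diff p \<nu> \<beta> h u\<bar> \<le> h powr (2 * \<nu>) * C / (\<Prod>i\<in>UNIV. 1 + \<bar>u $ i\<bar>)"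
    using mixture_diff_decay[OF nu p] by blast
  define D where "D = (\<Sum>a\<le>p. (diff_coeff p a)\<^sup>2)"
  have D: "D \<ge> 0" unfolding D_def by (intro sum_nonneg) auto
  have "(\<Sum>k\<in>grid n. (comb_cov {..p} (diff_coeff p) (mixture_kernel \<nu> \<beta>) \<sigma> (stencil x h k))\<^sup>2)
    \<le> (D * (p + 1) * C\<^sup>2 * 256) * (h powr (2 * \<nu>))\<^sup>2"
    if b: "\<beta> > 0" and h: "h > 0" for \<beta> h x \<sigma> n
  proof -
    let ?u = "\<lambda>k a. (\<chi> i. real (k i)) + (1 / h) *\<^sub>R (x - \<sigma> a)"
    have pt: "stencil x h k j - \<sigma> a = h *\<^sub>R (?u k a + real j *\<^sub>R e1)" for k j a
      using h by (simp add: stencil_def algebra_simps)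
    have cf: "comb_cov {..p} (diff_coeff p) (mixture_kernel \<nu> \<beta>) \<sigma> (stencil x h k) = (\<Sum>a\<le>p. diff_coeff p a * mixture_diff p \<nu> \<beta> h (?u k a))" for k
      unfolding comb_cov_def pt mixture_diff_def sum_distrib_left by (simp only: mult.assoc)
    have sq: "(mixture_diff p \<nu> \<beta> h u)\<^sup>2 \<le> (h powr (2 * \<nu>))\<^sup>2 * C\<^sup>2 * (1 / (\<Prod>i\<in>UNIV. 1 + \<bar>u $ i\<bar>))\<^sup>2" for u
    proof -
      have "\<bar>mixture_diff p \<nu> \<beta> h u\<bar>\<^sup>2 \<le> (h powr (2 * \<nu>) * C / (\<Prod>i\<in>UNIV. 1 + \<bar>u $ i\<bar>))\<^sup>2"
        by (intro power_mono dec b h) auto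
      then show ?thesis by (simp add: power_mult_distrib power_divide)
    qed
    have "(\<Sum>k\<in>grid n. (comb_cov {..p} (diff_coeff p) (mixture_kernel \<nu> \<beta>) \<sigma> (stencil x h k))\<^sup>2)
      \<le> (\<Sum>k\<in>grid n. D * (\<Sum>a\<le>p. (mixture_diff p \<nu> \<beta> h (?u k a))\<^sup>2))"
      unfolding cf D_def by (intro sum_mono Cauchy_Schwarz_ineq_sum)
    also have "\<dots> = D * (\<Sum>a\<le>p. \<Sum>k\<in>grid n. (mixture_diff p \<nu> \<beta> h (?u k a))\<^sup>2)"
      unfolding sum_distrib_left[symmetric] by (subst sum.swap) (rule refl)
    also have "\<dots> \<le> D * (\<Sum>a\<le>p. (h powr (2 * \<nu>))\<^sup>2 * C\<^sup>2 * 256)"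
    proof (intro mult_left_mono sum_mono D)
      fix a
      have "(\<Sum>k\<in>grid n. (mixture_diff p \<nu> \<beta> h (?u k a))\<^sup>2)
        \<le> (\<Sum>k\<in>grid n. (h powr (2 * \<nu>))\<^sup>2 * C\<^sup>2 * (1 / (\<Prod>i\<in>UNIV. 1 + \<bar>?u k a $ i\<bar>))\<^sup>2)"
        by (intro sum_mono sq)
      also have "\<dots> \<le> (h powr (2 * \<nu>))\<^sup>2 * C\<^sup>2 * 256"
        unfolding sum_distrib_left[symmetric] by (intro mult_left_mono grid_sum_le) auto
      finally show "(\<Sum>k\<in>grid n. (mixture_diff p \<nu> \<beta> h (?u k a))\<^sup>2) \<le> (h powr (2 * \<nu>))\<^sup>2 * C\<^sup>2 * 256" .
    qed
    finally show ?thesis by (simp add: mult_ac)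
  qed
  moreover have "D * (p + 1) * C\<^sup>2 * 256 \<ge> 0" using D by simp
  ultimately show ?thesis by blast
qed

lemma comb_cov_sym: "comb_cov J c (mixture_kernel \<nu> \<beta>) \<sigma> \<tau> = comb_cov J c (mixture_kernel \<nu> \<beta>) \<tau> \<sigma>"
  unfolding comb_cov_def by (subst sum.swap) (simp add: norm_minus_commute mult_ac)

lemma sum_geometric_dist:
  "(\<Sum>n<N. \<Sum>m<N. (1 / 2 :: real) ^ (if n \<le> m then m - n else n - m)) \<le> 4 * real N"
proof -
  have g: "(\<Sum>i<k. (1 / 2 :: real) ^ i) \<le> 2" for k by (simp add: sum_gp_strict)
  have "(\<Sum>m<N. (1 / 2 :: real) ^ (if n \<le> m then m - n else n - m)) \<le> 4" if n: "n < N" for n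
  proof -
    let ?f = "\<lambda>m. (1 / 2 :: real) ^ (if n \<le> m then m - n else n - m)"
    have "(\<Sum>m<N. ?f m) = (\<Sum>m<n. ?f m) + (\<Sum>m=n..<N. ?f m)"
      using sum.atLeastLessThan_concat[of 0 n N ?f] n by (simp add: lessThan_atLeast0)
    moreover have "(\<Sum>m<n. ?f m) \<le> 2"
    proof -
      have "(\<Sum>m<n. ?f m) = (\<Sum>m<n. ?f (n - Suc m))" by (rule sum.nat_diff_reindex[symmetric])
      also have "\<dots> \<le> (\<Sum>i<n. (1 / 2) ^ i)" by (intro sum_mono) (auto intro!: power_decreasing)
      also have "\<dots> \<le> 2" by (rule g)
      finally show ?thesis .
    qed
    moreover have "(\<Sum>m=n..<N. ?f m) \<le> 2"
    proof -
      have "(\<Sum>m=n..<N. ?f m) = (\<Sum>i<N - n. ?f (i + n))"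
        using sum.shift_bounds_nat_ivl[of ?f 0 n "N - n"] n by (simp add: lessThan_atLeast0)
      also have "\<dots> = (\<Sum>i<N - n. (1 / 2) ^ i)" by simp
      also have "\<dots> \<le> 2" by (rule g)
      finally show ?thesis .
    qed
    ultimately show ?thesis by linarith
  qed
  then have "(\<Sum>n<N. \<Sum>m<N. (1 / 2 :: real) ^ (if n \<le> m then m - n else n - m)) \<le> (\<Sum>n<N. 4)"
    by (intro sum_mono) auto
  then show ?thesis by simp
qed

section \<open>The multiscale statistic\<close>

lemma matern_field_centred_gaussian:
  assumes "matern_field M Y \<sigma> \<alpha> \<nu>"
  shows "centred_gaussian M Y (\<lambda>s t. matern_cov \<sigma> \<alpha> \<nu> (t - s))"
proof -
  have g: "gaussian_field M Y" and m: "\<And>t. (LINT \<omega>|M. Y t \<omega>) = 0"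
    and c: "\<And>s t. covariance M (Y s) (Y t) = matern_cov \<sigma> \<alpha> \<nu> (t - s)"
    using assms by (auto simp: matern_field_def)
  interpret prob_space M using g by (simp add: gaussian_field_def)
  show ?thesis
    by unfold_locales (use g m c in \<open>auto simp: covariance_def\<close>)
qed

lemma comb_cov_scale: "comb_cov J c (\<lambda>s t. q * K s t) \<sigma> \<tau> = q * comb_cov J c K \<sigma> \<tau>"
  unfolding comb_cov_def sum_distrib_left by (simp add: mult_ac)

lemma quad_mean_scale: "quad_mean I w J c \<tau> (\<lambda>s t. q * K s t) = q * quad_mean I w J c \<tau> K"
  unfolding quad_mean_def comb_cov_scale sum_distrib_left by (simp add: mult_ac)

lemma quad_var_scale: "quad_var I w J c \<tau> (\<lambda>s t. q * K s t) = q\<^sup>2 * quad_var I w J c \<tau> K"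
  unfolding quad_var_def comb_cov_scale sum_distrib_left by (simp add: power_mult_distrib mult_ac)

text \<open>Level \<open>n\<close> has spacing \<open>L / 2 ^ n\<close> and \<open>2 ^ n\<close> grid points per coordinate, which fill a box of fixed
  size. An increment of step \<open>h\<close> has variance of order \<open>h powr (2 \<nu>)\<close> and the parameters are visible
  at relative order \<open>h\<^sup>2\<close>; the weight \<open>h powr (2 - 2 \<nu>)\<close> is the inverse variance times the size of the
  effect, and makes the signal of each level independent of the level.\<close>

definition mesh :: "real \<Rightarrow> nat \<Rightarrow> real" where "mesh L n = L / 2 ^ n"

definition levels :: "nat \<Rightarrow> (nat \<times> (4 \<Rightarrow> nat)) set" where
  "levels N = (SIGMA n:{..<N}. grid (2 ^ n))"

definition weight :: "real \<Rightarrow> real \<Rightarrow> nat \<times> (4 \<Rightarrow> nat) \<Rightarrow> real" where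
  "weight \<nu> L i = mesh L (fst i) powr (2 - 2 * \<nu>)"

definition site :: "real^4 \<Rightarrow> real \<Rightarrow> nat \<times> (4 \<Rightarrow> nat) \<Rightarrow> nat \<Rightarrow> real^4" where
  "site x L i = stencil x (mesh L (fst i)) (snd i)"

lemma finite_levels: "finite (levels N)"
  unfolding levels_def by auto

lemma sum_levels:
  fixes f :: "nat \<Rightarrow> (4 \<Rightarrow> nat) \<Rightarrow> real"
  shows "(\<Sum>i\<in>levels N. f (fst i) (snd i)) = (\<Sum>n<N. \<Sum>k\<in>grid (2 ^ n). f n k)"
  unfolding levels_def by (subst sum.Sigma) (auto simp: case_prod_unfold)

lemma mesh_pos: "L > 0 \<Longrightarrow> mesh L n > 0" by (simp add: mesh_def)

lemma mesh_le: "L > 0 \<Longrightarrow> mesh L n \<le> L" by (simp add: mesh_def field_simps)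

lemma site_in_ball:
  assumes L: "L > 0" and \<rho>: "L * (5 + real p) \<le> \<rho>" and i: "i \<in> levels N" and a: "a \<le> p"
  shows "site x L i a \<in> ball x \<rho>"
proof -
  obtain n k where nk: "i = (n, k)" "k \<in> grid (2 ^ n)" using i by (auto simp: levels_def)
  let ?h = "mesh L n"
  have "norm ((\<chi> i. real (k i)) :: real^4) \<le> (\<Sum>i\<in>UNIV. \<bar>((\<chi> i. real (k i)) :: real^4) $ i\<bar>)"
    by (rule norm_le_l1_cart)
  also have "\<dots> \<le> (\<Sum>i\<in>(UNIV :: 4 set). 2 ^ n)"
  proof (intro sum_mono)
    fix i :: 4
    have "k i < 2 ^ n" using nk(2) by (auto simp: grid_def PiE_def Pi_def)
    then have "real (k i) < 2 ^ n" by (simp add: of_nat_less_numeral_power_cancel_iff)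
    then show "\<bar>((\<chi> i. real (k i)) :: real^4) $ i\<bar> \<le> 2 ^ n" by simp
  qed
  finally have 1: "norm ((\<chi> i. real (k i)) :: real^4) \<le> 4 * 2 ^ n" by simp
  have "norm ((\<chi> i. real (k i)) + real a *\<^sub>R e1) \<le> 4 * 2 ^ n + real a"
    by (rule order_trans[OF norm_triangle_ineq add_mono[OF 1]]) (simp add: norm_axis_1)
  then have "dist x (site x L i a) \<le> ?h * (4 * 2 ^ n + real a)"
    using mesh_pos[OF L, of n] by (simp add: site_def stencil_def nk dist_norm norm_minus_commute mult_left_mono)
  also have "\<dots> = L * 4 + ?h * real a" by (simp add: mesh_def field_simps)
  also have "\<dots> \<le> L * 4 + L * real p"
    by (intro add_mono mult_mono mesh_le L) (use a L in auto)
  also have "\<dots> < L * (5 + real p)" using L by (simp add: algebra_simps)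
  finally show ?thesis using \<rho> by simp
qed

text \<open>Each of the \<open>1 / h\<^sup>4\<close> (up to the factor \<open>L ^ 4\<close>) increments of a level contributes at least a multiple
  of \<open>h powr (2 - 2 \<nu>) * h powr (2 \<nu>) * h\<^sup>2 = h ^ 4\<close>. In dimension four their number offsets this
  power exactly, so every level contributes the same amount.\<close>

lemma quad_mean_gap:
  assumes nu: "\<nu> > 0" and b: "0 < \<beta>1" "\<beta>1 < \<beta>2" and L: "0 < L" "L \<le> 1"
  shows "\<exists>c>0. \<forall>N x. c * real N \<le>
    quad_mean (levels N) (weight \<nu> L) {..p} (diff_coeff p) (site x L) (mixture_kernel \<nu> \<beta>1)
     - quad_mean (levels N) (weight \<nu> L) {..p} (diff_coeff p) (site x L) (mixture_kernel \<nu> \<beta>2)"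
proof -
  let ?F = "\<lambda>\<beta> x h k. comb_cov {..p} (diff_coeff p) (mixture_kernel \<nu> \<beta>) (stencil x h k) (stencil x h k)"
  obtain c where c: "c > 0" and gap: "\<And>x h k. 0 < h \<Longrightarrow> h \<le> 1 \<Longrightarrow>
      c * (h powr (2 * \<nu>) * h\<^sup>2) \<le> ?F \<beta>1 x h k - ?F \<beta>2 x h k"
    using comb_cov_stencil_gap[OF nu b] by blast
  have "c * L ^ 4 * real N \<le> quad_mean (levels N) (weight \<nu> L) {..p} (diff_coeff p) (site x L) (mixture_kernel \<nu> \<beta>1)
     - quad_mean (levels N) (weight \<nu> L) {..p} (diff_coeff p) (site x L) (mixture_kernel \<nu> \<beta>2)" for N x
  proof -
    have "c * L ^ 4 * real N = (\<Sum>n<N. \<Sum>k\<in>grid (2 ^ n). mesh L n powr (2 - 2 * \<nu>) * (c * (mesh L n powr (2 * \<nu>) * (mesh L n)\<^sup>2)))"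
    proof -
      have level: "(\<Sum>k\<in>grid (2 ^ n). mesh L n powr (2 - 2 * \<nu>) * (c * (mesh L n powr (2 * \<nu>) * (mesh L n)\<^sup>2))) = c * L ^ 4" for n
      proof -
        have h: "mesh L n > 0" by (rule mesh_pos[OF L(1)])
        have "mesh L n powr (2 - 2 * \<nu>) * mesh L n powr (2 * \<nu>) = (mesh L n)\<^sup>2"
          using h by (simp flip: powr_add)
        then have "mesh L n powr (2 - 2 * \<nu>) * (c * (mesh L n powr (2 * \<nu>) * (mesh L n)\<^sup>2)) = c * ((mesh L n)\<^sup>2 * (mesh L n)\<^sup>2)"
          by (metis mult.assoc mult.left_commute)
        also have "(mesh L n)\<^sup>2 * (mesh L n)\<^sup>2 = L ^ 4 / (2 ^ n) ^ 4"
          by (simp add: mesh_def power_divide flip: power_add)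
        finally show ?thesis by (simp add: card_grid)
      qed
      show ?thesis unfolding level by simp
    qed
    also have "\<dots> \<le> (\<Sum>n<N. \<Sum>k\<in>grid (2 ^ n). mesh L n powr (2 - 2 * \<nu>) * (?F \<beta>1 x (mesh L n) k - ?F \<beta>2 x (mesh L n) k))"
      by (intro sum_mono mult_left_mono gap mesh_pos L order_trans[OF mesh_le]) auto
    also have "\<dots> = (\<Sum>i\<in>levels N. weight \<nu> L i * (?F \<beta>1 x (mesh L (fst i)) (snd i) - ?F \<beta>2 x (mesh L (fst i)) (snd i)))"
      unfolding weight_def by (rule sum_levels[symmetric])
    finally show ?thesis
      unfolding quad_mean_def site_def by (simp add: right_diff_distrib sum_subtractf)
  qed
  moreover have "c * L ^ 4 > 0" using c L by simp
  ultimately show ?thesis by blast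
qed

text \<open>For levels \<open>n \<le> m\<close>, \<open>comb_cov_sum_bound\<close> is applied to each of the \<open>(2 ^ n) ^ 4\<close> increments of the coarser
  level. The weights turn the result into a multiple of \<open>(1 / 2) powr ((2 + 2 \<nu>) (m - n))\<close>, which is
  summable away from the diagonal.\<close>

lemma quad_var_linear:
  assumes nu: "\<nu> > 0" and p: "real p \<ge> 4 + 4 * \<nu>" and L: "0 < L"
  shows "\<exists>C\<ge>0. \<forall>\<beta>>0. \<forall>N x. quad_var (levels N) (weight \<nu> L) {..p} (diff_coeff p) (site x L) (mixture_kernel \<nu> \<beta>) \<le> C * real N"
proof -
  obtain B where B: "B \<ge> 0" and bound: "\<And>\<beta> h x \<sigma> n. \<beta> > 0 \<Longrightarrow> h > 0 \<Longrightarrow>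
    (\<Sum>k\<in>grid n. (comb_cov {..p} (diff_coeff p) (mixture_kernel \<nu> \<beta>) \<sigma> (stencil x h k))\<^sup>2) \<le> B * (h powr (2 * \<nu>))\<^sup>2"
    using comb_cov_sum_bound[OF nu p] by blast
  have "quad_var (levels N) (weight \<nu> L) {..p} (diff_coeff p) (site x L) (mixture_kernel \<nu> \<beta>) \<le> (8 * B * L ^ 4) * real N"
    if b: "\<beta> > 0" for \<beta> N x
  proof -
    let ?F = "\<lambda>n k m l. (comb_cov {..p} (diff_coeff p) (mixture_kernel \<nu> \<beta>) (stencil x (mesh L n) k) (stencil x (mesh L m) l))\<^sup>2"
    let ?w = "\<lambda>n. mesh L n powr (2 - 2 * \<nu>)"
    define G where "G n k m l = ?w n * ?w m * ?F n k m l" for n k m l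
    define V where "V n m = (\<Sum>k\<in>grid (2 ^ n). \<Sum>l\<in>grid (2 ^ m). G n k m l)" for n m
    have Vsym: "V n m = V m n" for n m
      unfolding V_def G_def by (subst sum.swap) (simp add: comb_cov_sym[of _ _ _ _ "stencil x (mesh L n) _"] mult_ac)
    \<comment> \<open>level \<open>m\<close> is the finer one and is differenced, level \<open>n\<close> enters through its number of increments and its weight\<close>
    have Vle: "V n m \<le> B * L ^ 4 * (1 / 2) ^ (m - n)" if nm: "n \<le> m" for n m
    proof -
      have h: "mesh L n > 0" "mesh L m > 0" using mesh_pos[OF L] by auto
      have "V n m = (\<Sum>k\<in>grid (2 ^ n). ?w n * ?w m * (\<Sum>l\<in>grid (2 ^ m). ?F n k m l))"
        unfolding V_def G_def sum_distrib_left ..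
      also have "\<dots> \<le> (\<Sum>k\<in>grid (2 ^ n). ?w n * ?w m * (B * (mesh L m powr (2 * \<nu>))\<^sup>2))"
        by (intro sum_mono mult_left_mono bound b h) auto
      also have "\<dots> = (2 ^ n) ^ 4 * ?w n * (?w m * (mesh L m powr (2 * \<nu>))\<^sup>2) * B"
        by (simp add: card_grid)
      also have "?w m * (mesh L m powr (2 * \<nu>))\<^sup>2 = mesh L m powr (2 + 2 * \<nu>)"
        unfolding power2_eq_square by (simp add: add.commute flip: powr_add)
      \<comment> \<open>the number \<open>(2 ^ n) ^ 4\<close> of coarse increments is \<open>L ^ 4 / mesh L n ^ 4\<close>\<close>
      also have "(2 ^ n) ^ 4 * ?w n = L ^ 4 * mesh L n powr (- (2 + 2 * \<nu>))"
      proof -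
        have "?w n = (mesh L n) ^ 4 * mesh L n powr (- (2 + 2 * \<nu>))"
          using powr_add[of "mesh L n" 4 "- (2 + 2 * \<nu>)"] h(1) by simp
        then show ?thesis by (simp add: mesh_def power_divide)
      qed
      also have "L ^ 4 * mesh L n powr (- (2 + 2 * \<nu>)) * mesh L m powr (2 + 2 * \<nu>) * B
         = B * L ^ 4 * (mesh L m / mesh L n) powr (2 + 2 * \<nu>)"
        unfolding powr_minus_divide using h by (simp add: powr_divide)
      also have "mesh L m / mesh L n = (1 / 2) ^ (m - n)"
        using nm L by (simp add: mesh_def power_diff power_one_over field_simps)
      also have "B * L ^ 4 * ((1 / 2) ^ (m - n)) powr (2 + 2 * \<nu>) \<le> B * L ^ 4 * ((1 / 2) ^ (m - n)) powr 1"
        using B L nu by (intro mult_left_mono powr_mono') (auto simp: power_le_one)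
      finally show ?thesis by simp
    qed
    have "V n m \<le> B * L ^ 4 * (1 / 2) ^ (if n \<le> m then m - n else n - m)" for n m
      using Vle[of n m] Vle[of m n] Vsym[of n m] by auto
    then have "(\<Sum>n<N. \<Sum>m<N. V n m) \<le> (\<Sum>n<N. \<Sum>m<N. B * L ^ 4 * (1 / 2) ^ (if n \<le> m then m - n else n - m))"
      by (intro sum_mono)
    also have "\<dots> \<le> B * L ^ 4 * (4 * real N)"
      unfolding sum_distrib_left[symmetric] using B L by (intro mult_left_mono sum_geometric_dist) auto
    finally have V: "(\<Sum>n<N. \<Sum>m<N. V n m) \<le> B * L ^ 4 * (4 * real N)" .
    have "quad_var (levels N) (weight \<nu> L) {..p} (diff_coeff p) (site x L) (mixture_kernel \<nu> \<beta>)
       = 2 * (\<Sum>i\<in>levels N. \<Sum>j\<in>levels N. G (fst i) (snd i) (fst j) (snd j))"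
      unfolding quad_var_def weight_def site_def G_def ..
    also have "\<dots> = 2 * (\<Sum>i\<in>levels N. \<Sum>m<N. \<Sum>l\<in>grid (2 ^ m). G (fst i) (snd i) m l)"
      by (simp only: sum_levels[of "G _ _"])
    also have "\<dots> = 2 * (\<Sum>n<N. \<Sum>k\<in>grid (2 ^ n). \<Sum>m<N. \<Sum>l\<in>grid (2 ^ m). G n k m l)"
      by (simp only: sum_levels[of "\<lambda>n k. \<Sum>m<N. \<Sum>l\<in>grid (2 ^ m). G n k m l"])
    also have "\<dots> = 2 * (\<Sum>n<N. \<Sum>m<N. V n m)"
      unfolding V_def by (subst (2) sum.swap) (rule refl)
    finally show ?thesis using V by (simp add: mult_ac)
  qed
  moreover have "8 * B * L ^ 4 \<ge> 0" using B L by simp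
  ultimately show ?thesis by blast
qed

text \<open>The smaller inverse range \<open>\<alpha>1\<close> gives the larger increment variances. The signal is at least
  \<open>q c N\<close> and the variances are at most \<open>q\<^sup>2 C N\<close>. Asking only for two thirds of the signal, and for
  variances below \<open>q\<^sup>2 C N + 1\<close>, leaves room for the displacement of the sites into \<open>S\<close>.\<close>

lemma matern_laws_singular:
  assumes nu: "\<nu> > 0" and s: "\<sigma>1 > 0" and a: "\<alpha>1 > 0" "\<alpha>1 < \<alpha>2"
    and f1: "matern_field M1 Y1 \<sigma>1 \<alpha>1 \<nu>" and f2: "matern_field M2 Y2 \<sigma>2 \<alpha>2 \<nu>"
    and micro: "\<sigma>1\<^sup>2 * \<alpha>1 powr (2 * \<nu>) = \<sigma>2\<^sup>2 * \<alpha>2 powr (2 * \<nu>)"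
    and S: "ball x \<rho> \<subseteq> closure S" and \<rho>: "\<rho> > 0"
  shows "mutually_singular (process_law M1 S Y1) (process_law M2 S Y2)"
proof -
  define q where "q = 2 * 4 powr (- \<nu>) * (\<sigma>1\<^sup>2 * \<alpha>1 powr (2 * \<nu>)) / Gamma \<nu>"
  have q: "q > 0" unfolding q_def using s a nu by (simp add: Gamma_real_pos)
  define \<beta>1 \<beta>2 where "\<beta>1 = \<alpha>1\<^sup>2 / 4" and "\<beta>2 = \<alpha>2\<^sup>2 / 4"
  have b: "0 < \<beta>1" "\<beta>1 < \<beta>2" "0 < \<beta>2"
    using a by (auto simp: \<beta>1_def \<beta>2_def power_strict_mono)
  have a2: "\<alpha>2 > 0" using a by simp
  have G1: "centred_gaussian M1 Y1 (\<lambda>s t. q * mixture_kernel \<nu> \<beta>1 s t)"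
    using matern_field_centred_gaussian[OF f1] matern_cov_mixture[OF nu a(1), of \<sigma>1]
    by (simp add: q_def \<beta>1_def)
  have G2: "centred_gaussian M2 Y2 (\<lambda>s t. q * mixture_kernel \<nu> \<beta>2 s t)"
    using matern_field_centred_gaussian[OF f2] matern_cov_mixture[OF nu a2, of \<sigma>2]
    by (simp add: q_def micro \<beta>2_def)
  interpret G1: centred_gaussian M1 Y1 "\<lambda>s t. q * mixture_kernel \<nu> \<beta>1 s t" by (rule G1)
  interpret G2: centred_gaussian M2 Y2 "\<lambda>s t. q * mixture_kernel \<nu> \<beta>2 s t" by (rule G2)
  have cont: "continuous_on UNIV (\<lambda>(s, t). q * mixture_kernel \<nu> \<beta> s t)" if "\<beta> > 0" for \<beta>
    unfolding case_prod_unfold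
    by (intro continuous_intros continuous_on_compose2[OF continuous_mixture[OF nu that]]) auto
  define p where "p = nat \<lceil>4 + 4 * \<nu>\<rceil>"
  have p: "real p \<ge> 4 + 4 * \<nu>" unfolding p_def by linarith
  \<comment> \<open>the box has side \<open>L\<close> and its increments reach out by at most \<open>p * L\<close>, so all sites lie in the ball\<close>
  define L where "L = min 1 (\<rho> / (5 + real p))"
  have L: "0 < L" "L \<le> 1" using \<rho> by (auto simp: L_def)
  have L\<rho>: "L * (5 + real p) \<le> \<rho>"
  proof -
    have "L \<le> \<rho> / (5 + real p)" by (simp add: L_def)
    then show ?thesis by (simp add: field_simps)
  qed
  let ?m = "\<lambda>N. quad_mean (levels N) (weight \<nu> L) {..p} (diff_coeff p) (site x L)"
  let ?v = "\<lambda>N. quad_var (levels N) (weight \<nu> L) {..p} (diff_coeff p) (site x L)"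
  obtain c where c: "c > 0" and gap: "\<And>N. c * real N \<le> ?m N (mixture_kernel \<nu> \<beta>1) - ?m N (mixture_kernel \<nu> \<beta>2)"
    using quad_mean_gap[OF nu b(1,2) L] by blast
  obtain C where C: "C \<ge> 0" and var: "\<And>\<beta> N. \<beta> > 0 \<Longrightarrow> ?v N (mixture_kernel \<nu> \<beta>) \<le> C * real N"
    using quad_var_linear[OF nu p L(1)] by blast
  show ?thesis
  proof (rule mutually_singularI_separating)
    show "prob_space (process_law M1 S Y1)" "prob_space (process_law M2 S Y2)"
      by (rule G1.prob_space_process_law G2.prob_space_process_law)+
    show "sets (process_law M1 S Y1) = sets (process_law M2 S Y2)" by simp
    fix e :: real assume e: "e > 0"
    have "((\<lambda>N. (q\<^sup>2 * (C * real N) + 1) / (q * (c * real N) / 3)\<^sup>2) \<longlongrightarrow> 0) sequentially"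
      using q c by real_asymp
    then have "\<forall>\<^sub>F N in sequentially. (q\<^sup>2 * (C * real N) + 1) / (q * (c * real N) / 3)\<^sup>2 < e"
      using e by (rule order_tendstoD)
    then have "\<forall>\<^sub>F N in sequentially. 0 < N \<and> (q\<^sup>2 * (C * real N) + 1) / (q * (c * real N) / 3)\<^sup>2 < e"
      by (rule eventually_conj[OF eventually_gt_at_top])
    then obtain N where N: "N > 0" "(q\<^sup>2 * (C * real N) + 1) / (q * (c * real N) / 3)\<^sup>2 < e"
      by (auto dest!: eventually_happens)
    have "\<exists>A\<in>sets (\<Pi>\<^sub>M t\<in>S. borel).
      measure (process_law M1 S Y1) A \<le> (q\<^sup>2 * (C * real N) + 1) / (q * (c * real N) / 3)\<^sup>2 \<and>
      measure (process_law M2 S Y2) (space (\<Pi>\<^sub>M t\<in>S. borel) - A) \<le> (q\<^sup>2 * (C * real N) + 1) / (q * (c * real N) / 3)\<^sup>2"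
    proof (rule quad_stat_separates_closure[OF G1 G2])
      show "continuous_on UNIV (\<lambda>(s, t). q * mixture_kernel \<nu> \<beta>1 s t)" "continuous_on UNIV (\<lambda>(s, t). q * mixture_kernel \<nu> \<beta>2 s t)"
        using cont b by auto
      show "finite (levels N)" "finite {..p}" by (simp_all add: finite_levels)
      show "site x L i a \<in> closure S" if "i \<in> levels N" "a \<in> {..p}" for i a
        using site_in_ball[OF L(1) L\<rho> that(1), of a] that(2) S by auto
      show "0 < q * (c * real N) / 3" using q c N by simp
      have "2 * (q * (c * real N) / 3) < q * (c * real N)" using q c N by simp
      also have "\<dots> \<le> q * (?m N (mixture_kernel \<nu> \<beta>1) - ?m N (mixture_kernel \<nu> \<beta>2))"
        using q gap by (intro mult_left_mono) auto
      finally show "2 * (q * (c * real N) / 3) < ?m N (\<lambda>s t. q * mixture_kernel \<nu> \<beta>1 s t) - ?m N (\<lambda>s t. q * mixture_kernel \<nu> \<beta>2 s t)"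
        unfolding quad_mean_scale by (simp only: right_diff_distrib)
      have "?v N (\<lambda>s t. q * mixture_kernel \<nu> \<beta> s t) < q\<^sup>2 * (C * real N) + 1" if "\<beta> > 0" for \<beta>
        unfolding quad_var_scale using mult_left_mono[OF var[OF that, of N], of "q\<^sup>2"] by simp
      then show "?v N (\<lambda>s t. q * mixture_kernel \<nu> \<beta>1 s t) < q\<^sup>2 * (C * real N) + 1"
        "?v N (\<lambda>s t. q * mixture_kernel \<nu> \<beta>2 s t) < q\<^sup>2 * (C * real N) + 1" using b by auto
    qed
    then obtain A where "A \<in> sets (\<Pi>\<^sub>M t\<in>S. borel)" "measure (process_law M1 S Y1) A \<le> e"
      "measure (process_law M2 S Y2) (space (\<Pi>\<^sub>M t\<in>S. borel) - A) \<le> e"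
      using N(2) by (meson less_imp_le order_trans)
    then show "\<exists>A\<in>sets (process_law M1 S Y1). measure (process_law M1 S Y1) A \<le> e \<and>
        measure (process_law M2 S Y2) (space (process_law M2 S Y2) - A) \<le> e"
      by auto
  qed
qed

lemma interior_subset_closure_dense_grid: "interior D \<subseteq> closure (dense_grid D)"
proof
  fix x assume x: "x \<in> interior D"
  then obtain r where r: "r > 0" "ball x r \<subseteq> D" by (auto simp: mem_interior)
  show "x \<in> closure (dense_grid D)"
    unfolding closure_approachable
  proof safe
    fix e :: real assume e: "e > 0"
    obtain n :: nat where n: "n > 0" "4 / real n < min e r"
    proof -
      define m where "m = min e r"
      have m: "m > 0" using e r by (simp add: m_def)
      obtain n :: nat where n: "real n > 4 / m" using reals_Archimedean2 by blast
      have "0 < 4 / m" using m by simp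
      then have "0 < real n" using n by linarith
      then have "n > 0" "4 / real n < m" using n m by (simp_all add: field_simps)
      then have "n > 0" "4 / real n < min e r" by (simp_all only: m_def)
      then show thesis by (rule that)
    qed
    define z :: "real^4" where "z = (\<chi> i. of_int \<lfloor>real n * x $ i\<rfloor>)"
    let ?y = "(1 / real n) *\<^sub>R z"
    have "norm (?y - x) \<le> (\<Sum>i\<in>UNIV. \<bar>(?y - x) $ i\<bar>)" by (rule norm_le_l1_cart)
    also have "\<dots> \<le> (\<Sum>i\<in>(UNIV :: 4 set). 1 / real n)"
    proof (intro sum_mono)
      fix i
      have "(?y - x) $ i = (of_int \<lfloor>real n * x $ i\<rfloor> - real n * x $ i) / real n"
        using n by (simp add: z_def field_simps)
      moreover have "\<bar>of_int \<lfloor>real n * x $ i\<rfloor> - real n * x $ i\<bar> \<le> 1" by linarith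
      ultimately show "\<bar>(?y - x) $ i\<bar> \<le> 1 / real n" using n by (simp add: divide_right_mono)
    qed
    also have "\<dots> < min e r" using n by simp
    finally have d: "dist ?y x < min e r" by (simp add: dist_norm)
    then have "?y \<in> D" using r by (auto simp: dist_commute)
    moreover have "\<forall>i. z $ i \<in> \<int>" by (simp add: z_def)
    ultimately have "?y \<in> dense_grid D" unfolding dense_grid_def using n by (auto intro!: bexI[of _ n])
    then show "\<exists>y\<in>dense_grid D. dist y x < e" using d by auto
  qed
qed

theorem theorem1:
  fixes M1 :: "'a measure" and M2 :: "'b measure"
    and Y1 :: "real^4 \<Rightarrow> 'a \<Rightarrow> real" and Y2 :: "real^4 \<Rightarrow> 'b \<Rightarrow> real"
    and \<nu> \<sigma>1 \<sigma>2 \<alpha>1 \<alpha>2 :: real and D :: "(real^4) set"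
  assumes "\<nu> > 0" and "\<sigma>1 > 0" and "\<sigma>2 > 0" and "\<alpha>1 > 0" and "\<alpha>2 > 0"
    and "matern_field M1 Y1 \<sigma>1 \<alpha>1 \<nu>"
    and "matern_field M2 Y2 \<sigma>2 \<alpha>2 \<nu>"
    and "\<sigma>1\<^sup>2 * \<alpha>1 powr (2 * \<nu>) = \<sigma>2\<^sup>2 * \<alpha>2 powr (2 * \<nu>)"
    and "\<alpha>1 \<noteq> \<alpha>2"
    and "bounded D" and "interior D \<noteq> {}"
  shows "(\<forall>S. countable S \<and> S \<subseteq> D \<and> D \<subseteq> closure S \<longrightarrow>
            mutually_singular (process_law M1 S Y1) (process_law M2 S Y2)) \<and>
         mutually_singular (process_law M1 (dense_grid D) Y1) (process_law M2 (dense_grid D) Y2)"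
proof -
  obtain x r where r: "r > 0" "ball x r \<subseteq> interior D"
    using \<open>interior D \<noteq> {}\<close> open_interior[of D] by (metis all_not_in_conv open_contains_ball)
  have key: "mutually_singular (process_law M1 S Y1) (process_law M2 S Y2)"
    if "interior D \<subseteq> closure S" for S
  proof -
    have S: "ball x r \<subseteq> closure S" using r that by blast
    consider "\<alpha>1 < \<alpha>2" | "\<alpha>2 < \<alpha>1" using \<open>\<alpha>1 \<noteq> \<alpha>2\<close> by linarith
    then show ?thesis
    proof cases
      case 1
      show ?thesis
        by (rule matern_laws_singular[OF assms(1,2,4) 1 assms(6,7,8) S r(1)])
    next
      case 2
      have "mutually_singular (process_law M2 S Y2) (process_law M1 S Y1)"
        by (rule matern_laws_singular[OF assms(1,3,5) 2 assms(7,6) assms(8)[symmetric] S r(1)])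
      then show ?thesis by (rule mutually_singular_sym)
    qed
  qed
  have "interior D \<subseteq> closure S" if "D \<subseteq> closure S" for S
    using that interior_subset by blast
  then show ?thesis using key interior_subset_closure_dense_grid by blast
qed

end
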